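(* Let $L=\mathbb{Z}\alpha$ with $\langle\alpha,\alpha\rangle=2k$, where $k\geq 3$ is an integer. Then the vertex operator algebra $V_L^+$ satisfies the $C_2$ condition, i.e. $\dim V_L^+/C_2(V_L^+)<\infty$.
   Context: For a vertex operator algebra $V$ with vertex operators $Y(v,z)=\sum_{n\in\mathbb{Z}}v_nz^{-n-1}$, let $C_2(V)$ be the linear span of $\{v_{-2}u : u,v\in V\}$; $V$ satisfies the $C_2$ condition if $V/C_2(V)$ is finite dimensional. $L=\mathbb{Z}\alpha$ is a rank one positive definite even lattice with $\langle\alpha,\alpha\rangle=2k$, $\mathfrak{h}=\mathbb{C}\otimes_{\mathbb{Z}}L$, $M(1)$ is the Heisenberg Fock space (generated from $\mathbf{1}$ by the operators $\alpha(-n)$, $n>0$), and $V_L=M(1)\otimes\mathbb{C}[L]$ is the lattice vertex operator algebra with vacuum $\mathbf 1$ and conformal vector $\omega=\frac{1}{4k}\alpha(-1)^2\mathbf{1}$. Let $\theta$ be the automorphism of $V_L$ with $\theta(\alpha(-n_1)\cdots\alpha(-n_r)\otimes e^{\beta})=(-1)^r\alpha(-n_1)\cdots\alpha(-n_r)\otimes e^{-\beta}$; $V_L^+$ is the fixed point vertex operator subalgebra of $\theta$. *)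

theory Defs
  imports Complex_Main "HOL-Library.Function_Algebras"
begin

text \<open>
  Concrete model of the rank one lattice vertex operator algebra V_L, L = Z alpha,
  (alpha,alpha) = 2k.  A basis vector alpha(-1)^(lam 1) alpha(-2)^(lam 2) ... (x) e^(c alpha)
  is encoded as the pair (lam, c) with lam :: nat => nat finitely supported, lam 0 = 0.
  Vectors are finitely supported functions from such pairs to complex numbers.
\<close>

type_synonym mono = "nat \<Rightarrow> nat"
type_synonym bas = "mono \<times> int"
type_synonym vec = "bas \<Rightarrow> complex"

definition vsupp :: "('a \<Rightarrow> complex) \<Rightarrow> 'a set" where
  "vsupp f = {x. f x \<noteq> 0}"

definition msupp :: "mono \<Rightarrow> nat set" where
  "msupp lam = {j. lam j \<noteq> 0}"

definition is_mono :: "mono \<Rightarrow> bool" where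
  "is_mono lam \<longleftrightarrow> lam 0 = 0 \<and> finite (msupp lam)"

definition basis_set :: "bas set" where
  "basis_set = {b. is_mono (fst b)}"

definition mdeg :: "mono \<Rightarrow> nat" where
  "mdeg lam = (\<Sum>j\<in>msupp lam. lam j)"

definition mwt :: "mono \<Rightarrow> nat" where
  "mwt lam = (\<Sum>j\<in>msupp lam. j * lam j)"

text \<open>L_0-weight of a basis vector: partition weight plus (c alpha, c alpha)/2 = k c^2\<close>
definition bwt :: "nat \<Rightarrow> bas \<Rightarrow> nat" where
  "bwt k b = mwt (fst b) + k * nat (snd b * snd b)"

definition vwt :: "nat \<Rightarrow> vec \<Rightarrow> nat" where
  "vwt k u = (if vsupp u = {} then 0 else Max (bwt k ` vsupp u))"

definition bv :: "bas \<Rightarrow> vec" where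
  "bv b = (\<lambda>x. if x = b then 1 else 0)"

definition smul :: "complex \<Rightarrow> vec \<Rightarrow> vec" where
  "smul a f = (\<lambda>x. a * f x)"

definition lin :: "(bas \<Rightarrow> vec) \<Rightarrow> vec \<Rightarrow> vec" where
  "lin T f = (\<Sum>b\<in>vsupp f. smul (f b) (T b))"

definition VL :: "vec set" where
  "VL = {f. finite (vsupp f) \<and> vsupp f \<subseteq> basis_set}"

text \<open>Heisenberg operators alpha(n), normalised by [alpha(m),alpha(n)] = 2k m delta_{m+n,0}\<close>
definition heis :: "nat \<Rightarrow> int \<Rightarrow> bas \<Rightarrow> vec" where
  "heis k n b =
     (let lam = fst b; c = snd b in
      if n < 0 then bv (lam (nat (- n) := lam (nat (- n)) + 1), c)
      else if n = 0 then smul (of_int (2 * int k * c)) (bv b)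
      else smul (of_int (2 * int k * n * int (lam (nat n)))) (bv (lam (nat n := lam (nat n) - 1), c)))"

text \<open>
  Modes of e^(d alpha) (trivial cocycle), from
  Y(e^beta,z) = exp(sum_{n>0} beta(-n) z^n / n) exp(- sum_{n>0} beta(n) z^(-n) / n) e^beta z^beta(0).
  Applied to x^lam e^(c alpha), the term indexed by mu <= lam (from the annihilation part)
  and nu (from the creation part) carries the power
  z^(2 k d c + mwt nu - mwt mu); eop k d n picks the coefficient of z^(-n-1).
\<close>
definition eop :: "nat \<Rightarrow> int \<Rightarrow> int \<Rightarrow> bas \<Rightarrow> vec" where
  "eop k d n b =
     (let lam = fst b; c = snd b in
      (\<Sum>mu\<in>{mu. \<forall>j. mu j \<le> lam j}.
        (\<Sum>nu\<in>{nu. is_mono nu \<and> int (mwt nu) = int (mwt mu) - 2 * int k * d * c - n - 1}.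
           smul ((of_int (- 2 * int k * d)) ^ mdeg mu
                   * (\<Prod>j\<in>msupp mu. of_nat (lam j choose mu j))
                   * (\<Prod>j\<in>msupp nu. (of_int d / of_nat j) ^ nu j / fact (nu j)))
                (bv (\<lambda>j. lam j - mu j + nu j, c + d)))))"

text \<open>
  Modes of a general basis vector alpha(-j) w, by the iterate formula (a consequence of
  the Jacobi identity):
  (a_{-j} w)_n = sum_{i>=0} binom(j-1+i, i) (a_{-j-i} w_{n+i} + (-1)^(j+1) w_{n-j-i} a_i).
  The sum is truncated at a bound beyond which all terms vanish (by weight reasons).
  The first argument after k is fuel (the degree of the monomial).
\<close>
primrec modeaux :: "nat \<Rightarrow> nat \<Rightarrow> bas \<Rightarrow> int \<Rightarrow> vec \<Rightarrow> vec" where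
  "modeaux k 0 b n u = lin (eop k (snd b) n) u"
| "modeaux k (Suc r) b n u =
     (if fst b = (\<lambda>_. 0) then lin (eop k (snd b) n) u
      else
        (let j = (LEAST j. fst b j \<noteq> 0);
             w = ((fst b) (j := fst b j - 1), snd b);
             N = nat (int (bwt k w) + int (vwt k u) + \<bar>n\<bar>) + vwt k u + 1
         in (\<Sum>i\<in>{0..N}.
               smul (of_nat ((j - 1 + i) choose i))
                 (lin (heis k (- int (j + i))) (modeaux k r w (n + int i) u)
                  + smul ((- 1) ^ (j + 1))
                      (modeaux k r w (n - int j - int i) (lin (heis k (int i)) u))))))"

definition modeB :: "nat \<Rightarrow> bas \<Rightarrow> int \<Rightarrow> vec \<Rightarrow> vec" where
  "modeB k b n u = modeaux k (mdeg (fst b)) b n u"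

definition vmode :: "nat \<Rightarrow> vec \<Rightarrow> int \<Rightarrow> vec \<Rightarrow> vec" where
  "vmode k v n u = lin (\<lambda>b. modeB k b n u) v"

definition theta :: "vec \<Rightarrow> vec" where
  "theta f = (\<lambda>b. (- 1) ^ mdeg (fst b) * f (fst b, - snd b))"

definition VLplus :: "vec set" where
  "VLplus = {f \<in> VL. theta f = f}"

definition cspan :: "vec set \<Rightarrow> vec set" where
  "cspan S = {x. \<exists>F a. finite F \<and> F \<subseteq> S \<and> x = (\<Sum>v\<in>F. smul (a v) v)}"

definition C2plus :: "nat \<Rightarrow> vec set" where
  "C2plus k = cspan {vmode k v (-2) u | u v. u \<in> VLplus \<and> v \<in> VLplus}"

definition C2_cofinite :: "nat \<Rightarrow> bool" where
  "C2_cofinite k \<longleftrightarrow>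
     (\<exists>F. finite F \<and> F \<subseteq> VLplus \<and>
          (\<forall>v\<in>VLplus. \<exists>c\<in>C2plus k. v - c \<in> cspan F))"

end

theory Submission
  imports Defs
begin

text \<open>
  Let W = C_2(V_L^+). It suffices that every linear functional vanishing on W vanishes on the
  symmetrised basis vectors x^lam e^(c alpha) + theta(...), for all but finitely many (lam, c).
  Write xi_i = i! alpha(-i-1). Taking v = alpha(-a) alpha(-b) 1, the elements v_{-2} u give, up to
  terms of lower degree, xi_{i+1} xi_j r + xi_i xi_{j+1} r = 0 modulo W. By symmetry in three indices
  this kills every monomial of degree at least 3 that is not a power of xi_0, once
  the monomials of degree at most 2 are dead. In a sector c \<noteq> 0 the lower order terms, together with
  the relations v_{-2} 1, determine the monomials of degree at most 2 up to a scalar and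
  then force the scalar to be 0; for c = 0 they are killed in weight at least 10 by comparing
  (alpha(-2)^2)_{-2} alpha(-1) alpha(-d) with 2 (alpha(-1)^2)_{-2} alpha(-3) alpha(-d), whose
  leading terms agree. The remaining powers of alpha(-1) die because of E_{-2} u with
  E = e^(d alpha) + e^(- d alpha) and u a vector without factors alpha(-1): the Schur polynomial
  in e^(d alpha) then contains the power of alpha(-1) with a nonzero coefficient.
  Finally, for c \<ge> 3 the vectors of small weight are obtained from
  e^(alpha)_{-2} (p alpha(-r) e^((c-1) alpha)) with r large.
\<close>

section \<open>Monomials\<close>

interpretation vec: vector_space smul
  by unfold_locales (auto simp: smul_def algebra_simps fun_eq_iff)

lemma cspan_eq_span: "cspan S = vec.span S"
  unfolding cspan_def vec.span_explicit by blast

text \<open>A basis of the span stays independent after adjoining \<open>x\<close>, so a functional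
  may be prescribed as 1 at \<open>x\<close> and 0 on that basis. It turns membership in C_2 into a
  question about functionals.\<close>

lemma separating_functional:
  assumes "x \<notin> vec.span S"
  shows "\<exists>f :: vec \<Rightarrow> complex. (\<forall>y z. f (y + z) = f y + f z) \<and> (\<forall>a y. f (smul a y) = a * f y)
    \<and> (\<forall>s\<in>S. f s = 0) \<and> f x = 1"
proof -
  interpret vec_fun: vector_space_pair smul "(*) :: complex \<Rightarrow> complex \<Rightarrow> complex"
    by unfold_locales (simp_all add: algebra_simps)
  obtain B where B: "B \<subseteq> S" "\<not> vec.dependent B" "S \<subseteq> vec.span B"
    using vec.maximal_independent_subset by blast
  have sp: "vec.span B = vec.span S"
    using B by (meson subset_antisym vec.span_minimal vec.span_mono vec.subspace_span)
  hence "x \<notin> vec.span B" using assms by simp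
  hence ind: "\<not> vec.dependent (insert x B)" and xB: "x \<notin> B"
    using B(2) vec.independent_insert vec.span_base by auto
  obtain g where g: "Vector_Spaces.linear smul (*) g"
    "\<forall>y\<in>insert x B. g y = (if y = x then 1 else 0 :: complex)"
    using vec_fun.linear_independent_extend[OF ind, of "\<lambda>y. if y = x then 1 else 0"] by blast
  have "g s = 0" if "s \<in> S" for s
  proof (rule vec_fun.linear_eq_0_on_span[OF g(1)])
    show "s \<in> vec.span B" using B that by blast
    show "g y = 0" if "y \<in> B" for y using g(2) that xB by auto
  qed
  thus ?thesis using g vec_fun.linear_add[OF g(1)] vec_fun.linear_scale[OF g(1)] by (intro exI[of _ g]) simp
qed

text \<open>Monomials are written additively: \<open>dl i\<close> stands for the single factor
  alpha(-i), and adding it multiplies by that factor.\<close>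

definition dl :: "nat \<Rightarrow> mono" where
  "dl i = (\<lambda>x. if x = i then 1 else 0)"

lemma dl_apply [simp]: "dl i x = (if x = i then 1 else 0)"
  by (simp add: dl_def)

lemma is_mono_0 [simp]: "is_mono 0" by (simp add: is_mono_def msupp_def)

lemma is_mono_dl [simp]: "is_mono (dl i) \<longleftrightarrow> i > 0"
  by (auto simp: is_mono_def msupp_def)

lemma msupp_add [simp]: "msupp (a + b) = msupp a \<union> msupp b"
  by (auto simp: msupp_def)

lemma msupp_dl [simp]: "msupp (dl i) = {i}" by (auto simp: msupp_def)
lemma msupp_0 [simp]: "msupp 0 = {}" by (auto simp: msupp_def)

lemma is_mono_add [simp]: "is_mono (a + b) \<longleftrightarrow> is_mono a \<and> is_mono b"
  by (auto simp: is_mono_def)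

lemma mdeg_superset:
  assumes "finite A" "msupp l \<subseteq> A"
  shows "mdeg l = (\<Sum>j\<in>A. l j)"
  unfolding mdeg_def by (rule sum.mono_neutral_left) (use assms in \<open>auto simp: msupp_def\<close>)

lemma mwt_superset:
  assumes "finite A" "msupp l \<subseteq> A"
  shows "mwt l = (\<Sum>j\<in>A. j * l j)"
  unfolding mwt_def by (rule sum.mono_neutral_left) (use assms in \<open>auto simp: msupp_def\<close>)

lemma finite_msupp: "is_mono a \<Longrightarrow> finite (msupp a)" by (simp add: is_mono_def)

lemma mdeg_add [simp]:
  assumes "is_mono a" "is_mono b" shows "mdeg (a + b) = mdeg a + mdeg b"
  using assms mdeg_superset[of "msupp a \<union> msupp b"]
  by (simp add: finite_msupp sum.distrib)

lemma mwt_add [simp]: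
  assumes "is_mono a" "is_mono b" shows "mwt (a + b) = mwt a + mwt b"
  using assms mwt_superset[of "msupp a \<union> msupp b"]
  by (simp add: finite_msupp sum.distrib algebra_simps)

lemma mdeg_dl [simp]: "mdeg (dl i) = 1" by (simp add: mdeg_def)
lemma mwt_dl [simp]: "mwt (dl i) = i" by (simp add: mwt_def)
lemma mdeg_0 [simp]: "mdeg 0 = 0" by (simp add: mdeg_def)
lemma mwt_0 [simp]: "mwt 0 = 0" by (simp add: mwt_def)

lemma mono_upd_inc: "l(j := l j + 1) = l + dl j" by (auto simp: fun_eq_iff)
lemma mono_upd_dec: "(l + dl j)(j := (l + dl j) j - 1) = l" by (auto simp: fun_eq_iff)

lemma mono_part_le_mwt: "is_mono l \<Longrightarrow> j * l j \<le> mwt l"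
  using member_le_sum[of j "msupp l" "\<lambda>j. j * l j"] finite_msupp[of l]
  by (cases "l j = 0") (simp_all add: mwt_def msupp_def)

lemma mono_bounded:
  assumes "is_mono l" "mwt l \<le> n"
  shows "l j \<le> n" "j > n \<Longrightarrow> l j = 0"
proof -
  have *: "j * l j \<le> n" using mono_part_le_mwt[OF assms(1), of j] assms(2) by simp
  have "j = 0 \<Longrightarrow> l j = 0" using assms(1) by (simp add: is_mono_def)
  thus "l j \<le> n" using * by (cases j) auto
  show "l j = 0" if "j > n" using * that by (cases "l j") auto
qed

lemma finite_mono_mwt_le: "finite {l. is_mono l \<and> mwt l \<le> n}"
proof (rule finite_subset)
  show "{l. is_mono l \<and> mwt l \<le> n} \<subseteq> {l. \<forall>j. (j \<in> {..n} \<longrightarrow> l j \<in> {..n}) \<and> (j \<notin> {..n} \<longrightarrow> l j = 0)}"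
    using mono_bounded by auto
qed (rule finite_set_of_finite_funs; simp)

lemma mwt_eq_0_iff: "is_mono l \<Longrightarrow> mwt l = 0 \<longleftrightarrow> l = 0"
  using mono_bounded(1)[of l 0] mwt_0 by (metis bot_nat_0.extremum_uniqueI ext le_refl zero_fun_apply)

lemma mdeg_le_mwt: "is_mono l \<Longrightarrow> mdeg l \<le> mwt l"
  unfolding mdeg_def mwt_def
  by (rule sum_mono) (auto simp: msupp_def is_mono_def intro!: Suc_leI gr0I)

lemma mono_split:
  assumes "is_mono l" "l j \<noteq> 0"
  shows "\<exists>r. is_mono r \<and> l = r + dl j \<and> j > 0"
proof -
  let ?r = "l(j := l j - 1)"
  have l: "l = ?r + dl j" using assms by (auto simp: fun_eq_iff)
  thus ?thesis using assms(1) is_mono_add[of ?r "dl j"] is_mono_dl by metis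
qed

lemma mono_obtain_part:
  assumes "is_mono l" "mdeg l \<noteq> 0"
  obtains r i where "is_mono r" "l = r + dl (Suc i)"
proof -
  have "l \<noteq> 0" using assms(2) by (metis mdeg_0)
  then obtain j where "l j \<noteq> 0" by (auto simp: fun_eq_iff)
  with assms mono_split obtain r where "is_mono r" "l = r + dl j" "j > 0" by blast
  thus thesis using that[of r "j - 1"] by simp
qed

text \<open>This is the shape of the monomials in \<open>eop\<close>: \<open>mu\<close> is
  contracted out of \<open>l\<close> and \<open>nu\<close> is created. As \<open>mu\<close> lies
  below \<open>l\<close>, the subtraction of naturals is exact, so weight and degree
  balance.\<close>

lemma mono_sub_add:
  assumes "is_mono l" "\<forall>j. mu j \<le> l j" "is_mono nu"
  shows "is_mono mu" "is_mono (\<lambda>j. l j - mu j + nu j)"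
    "mwt (\<lambda>j. l j - mu j + nu j) + mwt mu = mwt l + mwt nu"
    "mdeg (\<lambda>j. l j - mu j + nu j) + mdeg mu = mdeg l + mdeg nu"
proof -
  have "msupp mu \<subseteq> msupp l" "msupp (\<lambda>j. l j - mu j) \<subseteq> msupp l"
    using assms(2) by (auto simp: msupp_def) (metis le_zero_eq neq0_conv)
  hence fin: "finite (msupp mu)" "finite (msupp (\<lambda>j. l j - mu j))"
    using finite_msupp[OF assms(1)] finite_subset by blast+
  show mu: "is_mono mu" using fin(1) assms(1,2)[unfolded is_mono_def] by (metis is_mono_def le_zero_eq)
  have d: "is_mono (\<lambda>j. l j - mu j)" using fin(2) assms(1) by (simp add: is_mono_def)
  have s: "(\<lambda>j. l j - mu j + nu j) = (\<lambda>j. l j - mu j) + nu" by (auto simp: fun_eq_iff)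
  have l: "l = (\<lambda>j. l j - mu j) + mu" using assms(2) by (auto simp: fun_eq_iff)
  show "is_mono (\<lambda>j. l j - mu j + nu j)" using s d assms(3) by simp
  show "mwt (\<lambda>j. l j - mu j + nu j) + mwt mu = mwt l + mwt nu"
    unfolding s using arg_cong[OF l, of mwt] by (simp add: d mu assms(3))
  show "mdeg (\<lambda>j. l j - mu j + nu j) + mdeg mu = mdeg l + mdeg nu"
    unfolding s using arg_cong[OF l, of mdeg] by (simp add: d mu assms(3))
qed

lemma finite_mono_le:
  assumes "is_mono l" shows "finite {mu. \<forall>j. mu j \<le> l j}"
proof (rule finite_subset[OF _ finite_mono_mwt_le])
  show "{mu. \<forall>j. mu j \<le> l j} \<subseteq> {m. is_mono m \<and> mwt m \<le> mwt l}"
  proof safe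
    fix mu assume mu: "\<forall>j. mu j \<le> l j"
    show "is_mono mu" "mwt mu \<le> mwt l"
      using mono_sub_add(1,3)[OF assms mu is_mono_0] by auto
  qed
qed

section \<open>Linear algebra in the lattice vertex algebra\<close>

\<comment> \<open>Resolution may leave vectors eta-expanded; these rules would then push the vector space operations
  under the abstraction and hide sums of vectors from the linearity lemmas.\<close>
declare plus_fun_apply [simp del] zero_fun_apply [simp del] uminus_apply [simp del] minus_apply [simp del]

section \<open>The space of vectors and linear extension from the basis\<close>

lemma vsupp_bv [simp]: "vsupp (bv b) = {b}" by (auto simp: vsupp_def bv_def)
lemma vsupp_0 [simp]: "vsupp 0 = {}" by (simp add: vsupp_def zero_fun_apply)

lemma VL_0 [simp]: "0 \<in> VL" by (simp add: VL_def)
lemma VL_bv [simp]: "bv b \<in> VL \<longleftrightarrow> b \<in> basis_set" by (simp add: VL_def)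

lemma VL_smul [simp]: "f \<in> VL \<Longrightarrow> smul a f \<in> VL"
  by (auto simp: VL_def vsupp_def smul_def elim: rev_finite_subset)

lemma VL_uminus [simp]: "f \<in> VL \<Longrightarrow> - f \<in> VL"
  using VL_smul[of f "- 1"] by simp

lemma VL_add [simp]: "f \<in> VL \<Longrightarrow> g \<in> VL \<Longrightarrow> f + g \<in> VL"
proof -
  assume *: "f \<in> VL" "g \<in> VL"
  have "vsupp (f + g) \<subseteq> vsupp f \<union> vsupp g" by (auto simp: vsupp_def plus_fun_apply)
  with * show ?thesis unfolding VL_def using finite_subset by blast
qed

lemma VL_sum [simp]: "(\<And>i. i \<in> A \<Longrightarrow> f i \<in> VL) \<Longrightarrow> sum f A \<in> VL"
  by (induction A rule: infinite_finite_induct) auto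

lemma lin_superset:
  assumes "finite A" "vsupp f \<subseteq> A"
  shows "lin T f = (\<Sum>b\<in>A. smul (f b) (T b))"
  unfolding lin_def
  by (rule sum.mono_neutral_left) (use assms in \<open>auto simp: vsupp_def smul_def fun_eq_iff zero_fun_apply\<close>)

text \<open>The support of a sum can shrink by cancellation, so all sums are taken over the union of
  the two supports.\<close>

lemma lin_add:
  assumes "f \<in> VL" "g \<in> VL" shows "lin T (f + g) = lin T f + lin T g"
proof -
  have "finite (vsupp f \<union> vsupp g)" "vsupp (f + g) \<subseteq> vsupp f \<union> vsupp g"
    using assms by (auto simp: VL_def vsupp_def plus_fun_apply)
  thus ?thesis
    by (simp add: lin_superset[of "vsupp f \<union> vsupp g"] plus_fun_apply vec.scale_left_distrib sum.distrib)
qed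

lemma lin_smul:
  assumes "f \<in> VL" shows "lin T (smul a f) = smul a (lin T f)"
proof -
  have "finite (vsupp f)" "vsupp (smul a f) \<subseteq> vsupp f"
    using assms by (auto simp: VL_def vsupp_def smul_def)
  thus ?thesis
    by (simp add: lin_superset[of "vsupp f"] vec.scale_sum_right smul_def[of a f])
qed

lemma lin_0 [simp]: "lin T 0 = 0" by (simp add: lin_def)
lemma lin_bv [simp]: "lin T (bv b) = T b" by (simp add: lin_def) (simp add: bv_def)

lemma sum_fun_apply: "(\<Sum>i\<in>A. f i) x = (\<Sum>i\<in>A. f i x)"
  for f :: "'i \<Rightarrow> 'x \<Rightarrow> 'y :: comm_monoid_add"
  by (induction A rule: infinite_finite_induct) (auto simp: plus_fun_apply zero_fun_apply)

lemma vec_expand: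
  assumes "finite (vsupp u)" shows "u = (\<Sum>b\<in>vsupp u. smul (u b) (bv b))"
proof
  fix x
  have "(\<Sum>b\<in>vsupp u. smul (u b) (bv b)) x = (\<Sum>b\<in>vsupp u. smul (u b) (bv b) x)"
    by (rule sum_fun_apply)
  thus "u x = (\<Sum>b\<in>vsupp u. smul (u b) (bv b)) x"
    using assms by (auto simp: smul_def bv_def vsupp_def if_distrib[of "(*) _"] cong: if_cong)
qed

lemma VL_induct [consumes 1, case_names zero basis add]:
  assumes "u \<in> VL" "P 0" "\<And>x b. b \<in> basis_set \<Longrightarrow> P (smul x (bv b))"
    "\<And>u v. u \<in> VL \<Longrightarrow> v \<in> VL \<Longrightarrow> P u \<Longrightarrow> P v \<Longrightarrow> P (u + v)"
  shows "P u"
proof -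
  have "P (\<Sum>b\<in>A. smul (u b) (bv b))" if "A \<subseteq> basis_set" for A
    using that
  proof (induction A rule: infinite_finite_induct)
    case (insert b F)
    hence "(\<Sum>b\<in>F. smul (u b) (bv b)) \<in> VL" by (intro VL_sum) auto
    with insert show ?case using assms(3,4) by simp
  qed (use assms(2) in simp_all)
  moreover have "finite (vsupp u)" "vsupp u \<subseteq> basis_set" using assms(1) by (simp_all add: VL_def)
  ultimately show ?thesis using vec_expand by metis
qed

lemma lin_VL: "(\<And>b. b \<in> basis_set \<Longrightarrow> T b \<in> VL) \<Longrightarrow> u \<in> VL \<Longrightarrow> lin T u \<in> VL"
  unfolding lin_def by (intro VL_sum VL_smul) (auto simp: VL_def)

lemma basis_set_iff [simp]: "(l, c) \<in> basis_set \<longleftrightarrow> is_mono l" by (simp add: basis_set_def)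

section \<open>The involution theta and symmetrisation\<close>

lemma theta_add: "theta (f + g) = theta f + theta g"
  by (simp add: plus_fun_apply theta_def fun_eq_iff algebra_simps)
lemma theta_smul: "theta (smul a f) = smul a (theta f)"
  by (simp add: theta_def smul_def fun_eq_iff algebra_simps)
lemma theta_bv: "theta (bv (l, c)) = smul ((- 1) ^ mdeg l) (bv (l, - c))"
proof
  fix x :: bas
  show "theta (bv (l, c)) x = smul ((- 1) ^ mdeg l) (bv (l, - c)) x"
    by (cases x) (auto simp: theta_def smul_def bv_def)
qed
lemma theta_uminus: "theta (- f) = - theta f" using theta_smul[of "- 1" f] by simp
lemma theta_0 [simp]: "theta 0 = 0" by (simp add: zero_fun_apply theta_def fun_eq_iff)
lemma theta_theta [simp]: "theta (theta f) = f"
  by (simp add: theta_def fun_eq_iff)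

lemma theta_VL: "u \<in> VL \<Longrightarrow> theta u \<in> VL"
proof (induction u rule: VL_induct)
  case (basis x b)
  thus ?case by (cases b) (simp add: theta_smul theta_bv)
next
  case (add u v)
  thus ?case by (simp add: theta_add)
qed simp

text \<open>On \<open>VL\<close> this is twice the projection onto the theta-fixed vectors.\<close>

definition symm :: "vec \<Rightarrow> vec" where "symm f = f + theta f"

lemma symm_add: "symm (f + g) = symm f + symm g" by (simp add: symm_def theta_add)
lemma symm_smul: "symm (smul a f) = smul a (symm f)"
  by (simp add: symm_def theta_smul vec.scale_right_distrib)
lemma symm_0 [simp]: "symm 0 = 0" by (simp add: symm_def)
lemma symm_sum: "symm (sum f A) = (\<Sum>i\<in>A. symm (f i))"
proof (induction A rule: infinite_finite_induct)
  case (insert x F)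
  thus ?case by (simp add: symm_add)
qed simp_all
lemma symm_VL: "u \<in> VL \<Longrightarrow> symm u \<in> VL" by (simp add: symm_def theta_VL)
lemma symm_theta: "symm (theta f) = symm f" by (simp add: symm_def add.commute)

lemma symm_VLplus: "u \<in> VL \<Longrightarrow> symm u \<in> VLplus"
  by (simp add: VLplus_def symm_VL) (simp add: symm_def theta_add add.commute)

lemma symm_bv_neg: "symm (bv (l, - c)) = smul ((- 1) ^ mdeg l) (symm (bv (l, c)))"
  using symm_theta[of "bv (l, c)"] unfolding theta_bv symm_smul
  by (metis (no_types, lifting) vec.scale_one vec.scale_scale power_mult_distrib[symmetric]
      minus_mult_minus mult_1 power_one)

lemma bv_vacuum: "bv (0, 0) \<in> VLplus"
  by (simp add: VLplus_def theta_bv)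

section \<open>Heisenberg operators and their compatibility with theta\<close>

definition al :: "nat \<Rightarrow> int \<Rightarrow> vec \<Rightarrow> vec" where
  "al k n u = lin (heis k n) u"

lemma heis_create: "j > 0 \<Longrightarrow> heis k (- int j) (l, c) = bv (l + dl j, c)"
  using mono_upd_inc[of l j] by (simp add: heis_def)

lemma heis_annihilate:
  "i > 0 \<Longrightarrow> heis k (int i) (l, c) =
    smul (of_nat (2 * k * i * l i)) (bv (l(i := l i - 1), c))"
  by (simp add: heis_def)

lemma heis_zero: "heis k 0 (l, c) = smul (of_nat (2 * k) * of_int c) (bv (l, c))"
  by (simp add: heis_def)

lemma is_mono_dec: "is_mono l \<Longrightarrow> is_mono (l(i := l i - 1))"
  by (auto simp: is_mono_def msupp_def intro: rev_finite_subset)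

lemma int_cases_heis:
  fixes n :: int
  obtains (neg) j where "j > 0" "n = - int j" | (zero) "n = 0" | (pos) i where "i > 0" "n = int i"
  by (metis int_cases3 zero_less_nat_eq gr0I of_nat_0_less_iff)

lemma heis_VL: "b \<in> basis_set \<Longrightarrow> heis k n b \<in> VL"
  by (cases b; cases n rule: int_cases_heis)
     (simp_all add: heis_create heis_annihilate heis_zero is_mono_dec del: One_nat_def)

lemma al_VL [simp]: "u \<in> VL \<Longrightarrow> al k n u \<in> VL"
  unfolding al_def by (rule lin_VL) (auto simp: heis_VL)

lemma al_add: "u \<in> VL \<Longrightarrow> v \<in> VL \<Longrightarrow> al k n (u + v) = al k n u + al k n v"
  by (simp add: al_def lin_add)
lemma al_smul: "u \<in> VL \<Longrightarrow> al k n (smul a u) = smul a (al k n u)"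
  by (simp add: al_def lin_smul)
lemma al_uminus: "u \<in> VL \<Longrightarrow> al k n (- u) = - al k n u"
  using al_smul[of u k n "- 1"] by simp
lemma al_0 [simp]: "al k n 0 = 0" by (simp add: al_def)
lemma al_bv: "al k n (bv b) = heis k n b" by (simp add: al_def)

lemma mdeg_dec:
  assumes "is_mono l" "l i \<noteq> 0" shows "mdeg l = Suc (mdeg (l(i := l i - 1)))"
proof -
  from mono_split[OF assms] obtain r where r: "is_mono r" "l = r + dl i" "i > 0" by blast
  thus ?thesis using mono_upd_dec[of r i] by simp
qed

text \<open>theta sends alpha to - alpha: creation and annihilation change the parity of the degree,
  and alpha(0) sees the sign of the charge.\<close>

lemma al_theta_basis:
  assumes "is_mono l"
  shows "al k n (theta (bv (l, c))) = - (theta (al k n (bv (l, c))))"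
proof (cases n rule: int_cases_heis)
  case (neg j)
  thus ?thesis using assms
    by (simp add: theta_bv al_smul al_bv heis_create)
next
  case zero
  thus ?thesis using assms
    by (simp add: theta_bv theta_smul al_smul al_bv heis_zero mult.commute)
next
  case (pos i)
  thus ?thesis using assms mdeg_dec[of l i]
    by (cases "l i = 0")
       (simp_all add: theta_bv theta_smul al_smul al_uminus al_bv heis_annihilate is_mono_dec mult.commute)
qed

lemma al_theta: "u \<in> VL \<Longrightarrow> al k n (theta u) = - (theta (al k n u))"
proof (induction u rule: VL_induct)
  case (basis x b)
  hence "al k n (theta (bv b)) = - (theta (al k n (bv b)))"
    using al_theta_basis[of "fst b" k n "snd b"] by (simp add: basis_set_def)
  with basis show ?case
    by (simp add: theta_smul al_smul theta_VL)
next
  case (add u v)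
  thus ?case by (simp add: theta_add al_add theta_VL minus_add_distrib)
qed simp

text \<open>The two signs from anticommuting with theta cancel, so quadratic expressions in the
  Heisenberg operators commute with symmetrisation.\<close>

lemma al_al_symm: "u \<in> VL \<Longrightarrow> al k m (al k n (symm u)) = symm (al k m (al k n u))"
  by (simp only: symm_def al_add al_theta al_uminus al_VL theta_VL VL_uminus theta_uminus minus_minus)

lemma bwt_le_vwt: "u \<in> VL \<Longrightarrow> u b \<noteq> 0 \<Longrightarrow> bwt k b \<le> vwt k u"
  by (cases b) (auto simp: vwt_def VL_def, auto simp: vsupp_def)

text \<open>alpha(i) removes a part of size \<open>i\<close>, and no basis vector in
  \<open>u\<close> has weight enough for one. This makes the mode sums finite.\<close>

lemma al_eq_0:
  assumes "u \<in> VL" "i > vwt k u" shows "al k (int i) u = 0"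
proof -
  have "smul (u b) (heis k (int i) b) = 0" if b: "b \<in> vsupp u" for b
  proof -
    obtain l c where [simp]: "b = (l, c)" by (cases b)
    have "is_mono l" using b assms by (auto simp: VL_def basis_set_def)
    moreover have "mwt l < i"
      using bwt_le_vwt[OF assms(1), of b k] b assms(2) by (auto simp: vsupp_def bwt_def)
    ultimately have "l i = 0" using mono_bounded(2)[of l "mwt l"] by simp
    thus ?thesis using \<open>mwt l < i\<close> by (simp add: heis_annihilate)
  qed
  thus ?thesis by (simp add: al_def lin_def sum.neutral)
qed

section \<open>Modes of simple vectors\<close>

lemma mono_le_zero: "{mu. \<forall>j. mu j \<le> (0 :: mono) j} = {0}"
  by (auto simp: zero_fun_apply fun_eq_iff)

text \<open>This is Y(1,z) = id. For charge 0 both exponentials are trivial: every nonempty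
  \<open>mu\<close> or \<open>nu\<close> carries a factor 0.\<close>

lemma eop_id:
  assumes "b \<in> basis_set" shows "eop k 0 n b = (if n = - 1 then bv b else 0)"
proof -
  obtain l c where b: "b = (l, c)" and l: "is_mono l" using assms by (cases b) auto
  have nu: "(\<Prod>j\<in>msupp nu. ((of_int 0 :: complex) / of_nat j) ^ nu j / fact (nu j)) = (if nu = 0 then 1 else 0)"
    if "is_mono nu" for nu
  proof (cases "nu = 0")
    case False
    then obtain j where "j \<in> msupp nu" by (auto simp: msupp_def fun_eq_iff zero_fun_apply)
    hence "\<exists>j\<in>msupp nu. ((of_int 0 :: complex) / of_nat j) ^ nu j / fact (nu j) = 0"
      by (intro bexI[of _ j]) (auto simp: msupp_def)
    thus ?thesis using False finite_msupp[OF that] by (simp add: prod_zero)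
  qed simp
  let ?N = "\<lambda>mu. {nu. is_mono nu \<and> int (mwt nu) = int (mwt mu) - 2 * int k * 0 * c - n - 1}"
  have fN: "finite (?N mu)" for mu
    by (rule finite_subset[OF _ finite_mono_mwt_le[of "nat (int (mwt mu) - n - 1)"]]) auto
  have F: "(\<Sum>nu\<in>?N mu. smul ((of_int (- 2 * int k * 0)) ^ mdeg mu
                   * (\<Prod>j\<in>msupp mu. of_nat (l j choose mu j))
                   * (\<Prod>j\<in>msupp nu. (of_int 0 / of_nat j) ^ nu j / fact (nu j)))
                (bv (\<lambda>j. l j - mu j + nu j, c + 0)))
       = (if mu = 0 then if n = - 1 then bv b else 0 else 0)" (is "sum ?f _ = _")
    if mu: "mu \<in> {mu. \<forall>j. mu j \<le> l j}" for mu
  proof (cases "mu = 0")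
    case False
    hence "mdeg mu \<noteq> 0"
      using mono_sub_add(1)[OF l _ is_mono_0, of mu] mu finite_msupp[of mu]
      by (auto simp: mdeg_def msupp_def fun_eq_iff zero_fun_apply)
    thus ?thesis using False by (simp add: sum.neutral)
  next
    case True
    have "sum ?f (?N mu) = (\<Sum>nu\<in>?N mu. if nu = 0 then bv b else 0)"
      by (rule sum.cong) (auto simp: True nu[simplified] b zero_fun_apply)
    also have "\<dots> = (if 0 \<in> ?N mu then bv b else 0)"
      using fN by simp
    finally show ?thesis using True by auto
  qed
  have "eop k 0 n b = (\<Sum>mu\<in>{mu. \<forall>j. mu j \<le> l j}. if mu = 0 then if n = - 1 then bv b else 0 else 0)"
    unfolding eop_def Let_def b fst_conv snd_conv by (rule sum.cong[OF refl], rule F[unfolded b])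
  also have "\<dots> = (if n = - 1 then bv b else 0)"
    using finite_mono_le[OF l] by (simp add: zero_fun_apply)
  finally show ?thesis .
qed

lemma lin_eop_id: "u \<in> VL \<Longrightarrow> lin (eop k 0 n) u = (if n = - 1 then u else 0)"
proof (induction u rule: VL_induct)
  case (basis x b)
  thus ?case by (simp add: lin_smul eop_id)
next
  case (add u v)
  thus ?case by (simp add: lin_add)
qed simp

text \<open>The recursion peels off the smallest part, which is \<open>j\<close> since
  \<open>w\<close> has no smaller one. Only a lower bound on the truncation point is kept, since in
  every use the terms beyond it are zero.\<close>

lemma modeaux_Suc:
  assumes "j > 0" "\<And>i. i < j \<Longrightarrow> w i = 0"
  shows "\<exists>N \<ge> mwt w + 2 * vwt k u + nat \<bar>n\<bar> + 1.
    modeaux k (Suc r) (w + dl j, c) n u = (\<Sum>i\<in>{0..N}.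
               smul (of_nat ((j - 1 + i) choose i))
                 (al k (- int (j + i)) (modeaux k r (w, c) (n + int i) u)
                  + smul ((- 1) ^ (j + 1))
                      (modeaux k r (w, c) (n - int j - int i) (al k (int i) u))))"
proof -
  have of_nat_plus_nonzero: "w + dl j \<noteq> (\<lambda>_. 0)" by (auto simp: fun_eq_iff plus_fun_apply)
  have j: "(LEAST i. (w + dl j) i \<noteq> 0) = j"
    by (rule Least_equality) (use assms(2) in \<open>force simp: plus_fun_apply intro: leI\<close>)+
  have w: "(w + dl j)(j := (w + dl j) j - 1) = w" by (rule mono_upd_dec)
  have "int (mwt w) \<le> int (bwt k (w, c))" by (simp add: bwt_def)
  hence bwt: "mwt w + 2 * vwt k u + nat \<bar>n\<bar> + 1
      \<le> nat (int (bwt k (w, c)) + int (vwt k u) + \<bar>n\<bar>) + vwt k u + 1" by linarith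
  show ?thesis
    unfolding modeaux.simps Let_def fst_conv snd_conv al_def j w if_not_P[OF of_nat_plus_nonzero]
    by (rule exI[of _ "nat (int (bwt k (w, c)) + int (vwt k u) + \<bar>n\<bar>) + vwt k u + 1"])
       (use bwt in simp)
qed

section \<open>Modes of linear and quadratic Heisenberg vectors\<close>

declare modeaux.simps(2) [simp del]

text \<open>The field of alpha(-b) 1 is the (b-1)-st derivative of alpha(z) divided by (b-1)!. Its
  modes are multiples of creation operators or of alpha(m), with a gap of b - 1 zero modes in
  between.\<close>

lemma mode_single:
  assumes "b > 0" "u \<in> VL"
  shows "modeaux k (Suc 0) (dl b, 0) (- 1 - int m) u
           = smul (of_nat ((b - 1 + m) choose m)) (al k (- int (b + m)) u)" (is ?A)
    and "modeaux k (Suc 0) (dl b, 0) (int (b - 1 + m)) u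
           = smul ((- 1) ^ (b + 1) * of_nat ((b - 1 + m) choose m)) (al k (int m) u)" (is ?B)
    and "p < b - 1 \<Longrightarrow> modeaux k (Suc 0) (dl b, 0) (int p) u = 0" (is "_ \<Longrightarrow> ?C")
proof -
  \<comment> \<open>The inner modes belong to the vacuum, so a summand survives only if its mode
    index is -1.\<close>
  have ex: "\<exists>N \<ge> nat \<bar>n\<bar>. modeaux k (Suc 0) (dl b, 0) n u = (\<Sum>i\<in>{0..N}.
      smul (of_nat ((b - 1 + i) choose i))
        ((if n + int i = - 1 then al k (- int (b + i)) u else 0)
         + (if n - int b - int i = - 1 then smul ((- 1) ^ (b + 1)) (al k (int i) u) else 0)))" for n
  proof -
    obtain N where N: "N \<ge> nat \<bar>n\<bar>" "modeaux k (Suc 0) (0 + dl b, 0) n u = (\<Sum>i\<in>{0..N}.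
               smul (of_nat ((b - 1 + i) choose i))
                 (al k (- int (b + i)) (modeaux k 0 (0, 0) (n + int i) u)
                  + smul ((- 1) ^ (b + 1))
                      (modeaux k 0 (0, 0) (n - int b - int i) (al k (int i) u))))"
    proof -
      have "i < b \<Longrightarrow> (0 :: mono) i = 0" for i by (simp add: zero_fun_apply)
      from modeaux_Suc[of b 0 k u n 0 0, OF assms(1) this] obtain N where
        "N \<ge> mwt 0 + 2 * vwt k u + nat \<bar>n\<bar> + 1"
        "modeaux k (Suc 0) (0 + dl b, 0) n u = (\<Sum>i\<in>{0..N}.
               smul (of_nat ((b - 1 + i) choose i))
                 (al k (- int (b + i)) (modeaux k 0 (0, 0) (n + int i) u)
                  + smul ((- 1) ^ (b + 1))
                      (modeaux k 0 (0, 0) (n - int b - int i) (al k (int i) u))))" by blast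
      thus thesis by (intro that[of N]) linarith+
    qed
    show ?thesis
      by (rule exI[of _ N], rule conjI, fact N(1), subst add_0_left[symmetric], subst N(2), rule sum.cong)
         (simp_all add: lin_eop_id assms)
  qed
  obtain N where N: "N \<ge> nat \<bar>- 1 - int m\<bar>"
    "modeaux k (Suc 0) (dl b, 0) (- 1 - int m) u = (\<Sum>i\<in>{0..N}.
      smul (of_nat ((b - 1 + i) choose i))
        ((if - 1 - int m + int i = - 1 then al k (- int (b + i)) u else 0)
         + (if - 1 - int m - int b - int i = - 1 then smul ((- 1) ^ (b + 1)) (al k (int i) u) else 0)))"
    using ex[of "- 1 - int m"] by blast
  note N(2)
  also have "(\<Sum>i\<in>{0..N}. smul (of_nat ((b - 1 + i) choose i))
        ((if - 1 - int m + int i = - 1 then al k (- int (b + i)) u else 0)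
         + (if - 1 - int m - int b - int i = - 1 then smul ((- 1) ^ (b + 1)) (al k (int i) u) else 0)))
    = (\<Sum>i\<in>{0..N}. if i = m then smul (of_nat ((b - 1 + i) choose i)) (al k (- int (b + i)) u) else 0)"
    by (rule sum.cong) (use assms in auto)
  also have "\<dots> = smul (of_nat ((b - 1 + m) choose m)) (al k (- int (b + m)) u)"
    using N(1) by (auto simp: sum.delta nat_le_iff)
  finally show ?A .
  obtain N where N: "N \<ge> nat \<bar>int (b - 1 + m)\<bar>"
    "modeaux k (Suc 0) (dl b, 0) (int (b - 1 + m)) u = (\<Sum>i\<in>{0..N}.
      smul (of_nat ((b - 1 + i) choose i))
        ((if int (b - 1 + m) + int i = - 1 then al k (- int (b + i)) u else 0)
         + (if int (b - 1 + m) - int b - int i = - 1 then smul ((- 1) ^ (b + 1)) (al k (int i) u) else 0)))"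
    using ex[of "int (b - 1 + m)"] by blast
  note N(2)
  also have "(\<Sum>i\<in>{0..N}. smul (of_nat ((b - 1 + i) choose i))
        ((if int (b - 1 + m) + int i = - 1 then al k (- int (b + i)) u else 0)
         + (if int (b - 1 + m) - int b - int i = - 1 then smul ((- 1) ^ (b + 1)) (al k (int i) u) else 0)))
    = (\<Sum>i\<in>{0..N}. if i = m then smul ((- 1) ^ (b + 1) * of_nat ((b - 1 + i) choose i)) (al k (int i) u) else 0)"
    by (rule sum.cong) (use assms in \<open>auto simp: mult.commute\<close>)
  also have "\<dots> = smul ((- 1) ^ (b + 1) * of_nat ((b - 1 + m) choose m)) (al k (int m) u)"
    using N(1) assms(1) by (simp add: sum.delta)
  finally show ?B .
  assume p: "p < b - 1"
  obtain N where N: "N \<ge> nat \<bar>int p\<bar>"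
    "modeaux k (Suc 0) (dl b, 0) (int p) u = (\<Sum>i\<in>{0..N}.
      smul (of_nat ((b - 1 + i) choose i))
        ((if int p + int i = - 1 then al k (- int (b + i)) u else 0)
         + (if int p - int b - int i = - 1 then smul ((- 1) ^ (b + 1)) (al k (int i) u) else 0)))"
    using ex[of "int p"] by blast
  note N(2)
  also have "(\<Sum>i\<in>{0..N}. smul (of_nat ((b - 1 + i) choose i))
        ((if int p + int i = - 1 then al k (- int (b + i)) u else 0)
         + (if int p - int b - int i = - 1 then smul ((- 1) ^ (b + 1)) (al k (int i) u) else 0))) = 0"
    by (rule sum.neutral) (use p in auto)
  finally show ?C .
qed

\<comment> \<open>Coefficient of alpha(-a-b-1-i) alpha(i) in the mode (alpha(-a) alpha(-b) 1)_{-2}.\<close>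
definition quad_coeff :: "nat \<Rightarrow> nat \<Rightarrow> nat \<Rightarrow> complex" where
  "quad_coeff a b i = (- 1) ^ (b + 1) * of_nat ((a + b + i) choose (b + 1 + i)) * of_nat ((b - 1 + i) choose i)
     + (- 1) ^ (a + 1) * of_nat ((a + b + i) choose (a + 1 + i)) * of_nat ((a - 1 + i) choose i)"

text \<open>In the iterate formula the first family gives the two creation terms at i = 0 and i = 1,
  vanishes up to i = b, and from i = b + 1 on supplies alpha(i - b - 1); the second family supplies
  the other summand of \<open>quad_coeff\<close>. Assuming \<open>a \<le> b\<close> makes
  \<open>a\<close> the part that is peeled off first.\<close>

lemma mode_quadratic:
  assumes "0 < a" "a \<le> b" "u \<in> VL" "K \<ge> vwt k u"
  shows "modeaux k (Suc (Suc 0)) (dl b + dl a, 0) (- 2) u =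
      smul (of_nat a) (al k (- int (a + 1)) (al k (- int b) u))
    + smul (of_nat b) (al k (- int a) (al k (- int (b + 1)) u))
    + (\<Sum>i\<le>K. smul (quad_coeff a b i) (al k (- int (a + b + 1 + i)) (al k (int i) u)))"
proof -
  have b: "b > 0" using assms by simp
  let ?M = "modeaux k (Suc 0) (dl b, 0)"
  obtain N where N: "N \<ge> b + 2 * vwt k u + 3"
    "modeaux k (Suc (Suc 0)) (dl b + dl a, 0) (- 2) u = (\<Sum>i\<in>{0..N}.
       smul (of_nat ((a - 1 + i) choose i))
         (al k (- int (a + i)) (?M (- 2 + int i) u)
          + smul ((- 1) ^ (a + 1)) (?M (- 2 - int a - int i) (al k (int i) u))))"
  proof -
    have "i < a \<Longrightarrow> dl b i = 0" for i using assms(2) by simp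
    from modeaux_Suc[of a "dl b" k u "- 2" "Suc 0" 0, OF assms(1) this] obtain N where
      "N \<ge> mwt (dl b) + 2 * vwt k u + nat \<bar>- 2\<bar> + 1"
      "modeaux k (Suc (Suc 0)) (dl b + dl a, 0) (- 2) u = (\<Sum>i\<in>{0..N}.
       smul (of_nat ((a - 1 + i) choose i))
         (al k (- int (a + i)) (?M (- 2 + int i) u)
          + smul ((- 1) ^ (a + 1)) (?M (- 2 - int a - int i) (al k (int i) u))))"
      by blast
    thus ?thesis using that[of N] by simp
  qed
  define F where "F = (\<lambda>i. smul (of_nat ((a - 1 + i) choose i)) (al k (- int (a + i)) (?M (- 2 + int i) u)))"
  define G where "G = (\<lambda>i. smul (of_nat ((a - 1 + i) choose i) * (- 1) ^ (a + 1))
      (?M (- 2 - int a - int i) (al k (int i) u)))"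
  have M0: "?M n 0 = 0" for n
    using modeaux_Suc[of b 0 k 0 n 0 0] b by (auto simp: zero_fun_apply)
  have al0: "al k (int i) u = 0" if "i \<notin> {..vwt k u}" for i
    using al_eq_0[OF assms(3), of k i] that by simp
  have sumG: "sum G {0..N} = (\<Sum>i\<le>vwt k u. smul ((- 1) ^ (a + 1) * of_nat ((a + b + i) choose (a + 1 + i))
        * of_nat ((a - 1 + i) choose i)) (al k (- int (a + b + 1 + i)) (al k (int i) u)))"
  proof (rule sum.mono_neutral_cong_right)
    fix i assume "i \<in> {..vwt k u}"
    have e: "- 2 - int a - int i = - 1 - int (a + 1 + i)" by simp
    show "G i = smul ((- 1) ^ (a + 1) * of_nat ((a + b + i) choose (a + 1 + i))
        * of_nat ((a - 1 + i) choose i)) (al k (- int (a + b + 1 + i)) (al k (int i) u))"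
      using b unfolding G_def e
      by (subst mode_single(1)[OF b]) (simp_all add: assms algebra_simps)
  qed (use N(1) al0 in \<open>auto simp: G_def M0\<close>)
  have F0: "F 0 = smul (of_nat b) (al k (- int a) (al k (- int (b + 1)) u))"
    using mode_single(1)[OF b assms(3), of k 1] b by (simp add: F_def al_smul assms(3))
  have F1: "F 1 = smul (of_nat a) (al k (- int (a + 1)) (al k (- int b) u))"
    using mode_single(1)[OF b assms(3), of k 0] assms(1,3) by (simp add: F_def algebra_simps)
  have F2: "F (b + 1 + i) = smul ((- 1) ^ (b + 1) * of_nat ((a + b + i) choose (b + 1 + i))
        * of_nat ((b - 1 + i) choose i)) (al k (- int (a + b + 1 + i)) (al k (int i) u))" for i
  proof -
    have M: "?M (- 2 + int (b + 1 + i)) u = smul ((- 1) ^ (b + 1) * of_nat ((b - 1 + i) choose i)) (al k (int i) u)"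
      using mode_single(2)[OF b assms(3), of k i] b by (simp add: of_nat_diff algebra_simps)
    have e: "a - 1 + (b + 1 + i) = a + b + i" "a + (b + 1 + i) = a + b + 1 + i"
      using assms(1) by auto
    show ?thesis unfolding F_def M e by (simp only: al_smul al_VL assms(3) vec.scale_scale mult_ac)
  qed
  \<comment> \<open>The indices where \<open>F\<close> can be nonzero: those from 2 to b hit the gap
    of zero modes, and beyond b + 1 + \<open>vwt k u\<close> the annihilation operator kills
    \<open>u\<close>.\<close>
  let ?S = "{0, 1} \<union> (\<lambda>i. b + 1 + i) ` {..vwt k u}"
  have "sum F {0..N} = sum F ?S"
  proof (rule sum.mono_neutral_right)
    show "\<forall>i\<in>{0..N} - ?S. F i = 0"
    proof
      fix i assume i: "i \<in> {0..N} - ?S"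
      show "F i = 0"
      proof (cases "i < b + 1")
        case True
        hence "i - 2 < b - 1" "i \<ge> 2" using i b by auto
        thus ?thesis using mode_single(3)[OF b assms(3), of "i - 2" k]
          by (simp add: F_def of_nat_diff)
      next
        case False
        hence e: "i = b + 1 + (i - b - 1)" by simp
        hence "i - b - 1 \<notin> {..vwt k u}" using i by blast
        thus ?thesis using F2[of "i - b - 1", folded e] al0[of "i - b - 1"] by simp
      qed
    qed
  qed (use N(1) in auto)
  also have "\<dots> = F 0 + F 1 + (\<Sum>i\<le>vwt k u. F (b + 1 + i))"
    using b by (subst sum.union_disjoint) (auto simp: sum.reindex inj_on_def)
  finally have sumF: "sum F {0..N} = \<dots>" .
  have "modeaux k (Suc (Suc 0)) (dl b + dl a, 0) (- 2) u = sum F {0..N} + sum G {0..N}"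
    unfolding N(2) F_def G_def sum.distrib[symmetric]
    by (rule sum.cong) (simp_all only: vec.scale_right_distrib vec.scale_scale)
  also have "\<dots> = smul (of_nat a) (al k (- int (a + 1)) (al k (- int b) u))
    + smul (of_nat b) (al k (- int a) (al k (- int (b + 1)) u))
    + (\<Sum>i\<le>vwt k u. smul (quad_coeff a b i) (al k (- int (a + b + 1 + i)) (al k (int i) u)))"
    unfolding sumF sumG F0 F1 F2 quad_coeff_def vec.scale_left_distrib sum.distrib
    by (simp add: add_ac)
  also have "(\<Sum>i\<le>vwt k u. smul (quad_coeff a b i) (al k (- int (a + b + 1 + i)) (al k (int i) u)))
     = (\<Sum>i\<le>K. smul (quad_coeff a b i) (al k (- int (a + b + 1 + i)) (al k (int i) u)))"
    by (rule sum.mono_neutral_left) (use assms(4) al0 in auto)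
  finally show ?thesis .
qed

section \<open>Modes applied to the vacuum\<close>

lemma mwt_one: "{nu. is_mono nu \<and> mwt nu = 1} = {dl 1}"
proof -
  have "nu = dl 1" if nu: "is_mono nu" "mwt nu = 1" for nu
  proof -
    have "nu \<noteq> 0" using nu(2) by auto
    then obtain j where "nu j \<noteq> 0" by (auto simp: fun_eq_iff zero_fun_apply)
    then obtain r where r: "is_mono r" "nu = r + dl j" "j > 0" using mono_split[OF nu(1)] by blast
    hence "mwt r = 0" "j = 1" using nu(2) by auto
    thus ?thesis using r mwt_eq_0_iff by auto
  qed
  thus ?thesis by auto
qed

text \<open>Nothing can be contracted from the vacuum, which leaves the Schur polynomials of the
  creation exponential.\<close>

lemma eop_vacuum:
  "eop k d n (0, 0) = (\<Sum>nu\<in>{nu. is_mono nu \<and> int (mwt nu) = - n - 1}.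
     smul (\<Prod>j\<in>msupp nu. (of_int d / of_nat j) ^ nu j / fact (nu j)) (bv (nu, d)))"
  unfolding eop_def Let_def fst_conv snd_conv mono_le_zero by (simp add: zero_fun_apply)

lemma modeaux_0: "modeaux k r b n 0 = 0"
  by (induction r arbitrary: b n) (simp_all add: modeaux.simps(2) Let_def)

lemma al_vacuum: "al k (int i) (bv (0, 0)) = 0"
  by (cases "i = 0") (simp_all add: al_bv heis_zero heis_annihilate zero_fun_apply)

text \<open>The rules v_n 1 = 0 for n >= 0, v_{-1} 1 = v and v_{-2} 1 = L(-1) v are passed on when a
  smallest part is prepended. All alpha(i) with i >= 0 kill the vacuum, so only the first family of
  the iterate formula remains, and for the mode -2 only its terms i = 0 and i = 1.\<close>

lemma mode_vacuum_step:
  assumes "j > 0" "\<And>i. i < j \<Longrightarrow> w i = 0" "is_mono w"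
    and nonneg: "\<And>n. n \<ge> 0 \<Longrightarrow> modeaux k r (w, c) n (bv (0, 0)) = 0"
    and minus1: "modeaux k r (w, c) (- 1) (bv (0, 0)) = bv (w, c)"
  shows "n \<ge> 0 \<Longrightarrow> modeaux k (Suc r) (w + dl j, c) n (bv (0, 0)) = 0"
    and "modeaux k (Suc r) (w + dl j, c) (- 1) (bv (0, 0)) = bv (w + dl j, c)"
    and "modeaux k (Suc r) (w + dl j, c) (- 2) (bv (0, 0)) =
           al k (- int j) (modeaux k r (w, c) (- 2) (bv (0, 0)))
         + smul (of_nat j) (bv (w + dl (j + 1), c))"
proof -
  let ?F = "\<lambda>n i. smul (of_nat ((j - 1 + i) choose i))
                 (al k (- int (j + i)) (modeaux k r (w, c) (n + int i) (bv (0, 0))))"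
  have ex: "\<exists>N \<ge> nat \<bar>n\<bar>. modeaux k (Suc r) (w + dl j, c) n (bv (0, 0)) = sum (?F n) {0..N}" for n
  proof -
    from modeaux_Suc[of j w k "bv (0, 0)" n r c, OF assms(1,2)] obtain N where
      "N \<ge> mwt w + 2 * vwt k (bv (0, 0)) + nat \<bar>n\<bar> + 1"
      "modeaux k (Suc r) (w + dl j, c) n (bv (0, 0)) = sum (?F n) {0..N}"
      by (auto simp: al_vacuum modeaux_0)
    thus ?thesis by (intro exI[of _ N]) simp
  qed
  show "modeaux k (Suc r) (w + dl j, c) n (bv (0, 0)) = 0" if "n \<ge> 0"
    using ex[of n] that by (auto simp: nonneg)
  obtain N where N: "N \<ge> nat \<bar>- 1\<bar>" "modeaux k (Suc r) (w + dl j, c) (- 1) (bv (0, 0)) = sum (?F (- 1)) {0..N}"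
    using ex[of "- 1"] by blast
  note N(2)
  also have "sum (?F (- 1)) {0..N} = sum (?F (- 1)) {0}"
    by (rule sum.mono_neutral_right) (auto simp: nonneg)
  finally show "modeaux k (Suc r) (w + dl j, c) (- 1) (bv (0, 0)) = bv (w + dl j, c)"
    using assms(1) by (simp add: minus1 al_bv heis_create)
  obtain N where N: "N \<ge> nat \<bar>- 2\<bar>" "modeaux k (Suc r) (w + dl j, c) (- 2) (bv (0, 0)) = sum (?F (- 2)) {0..N}"
    using ex[of "- 2"] by blast
  note N(2)
  also have "sum (?F (- 2)) {0..N} = sum (?F (- 2)) {0, 1}"
    by (rule sum.mono_neutral_right) (use N(1) in \<open>auto simp: nonneg\<close>)
  finally show "modeaux k (Suc r) (w + dl j, c) (- 2) (bv (0, 0)) =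
           al k (- int j) (modeaux k r (w, c) (- 2) (bv (0, 0)))
         + smul (of_nat j) (bv (w + dl (j + 1), c))"
    using assms(1) heis_create[of "Suc j" k w c] by (simp add: minus1 al_bv algebra_simps)
qed

lemma mode_vacuum_0:
  "n \<ge> 0 \<Longrightarrow> modeaux k 0 (0, c) n (bv (0, 0)) = 0"
  "modeaux k 0 (0, c) (- 1) (bv (0, 0)) = bv (0, c)"
  "modeaux k 0 (0, c) (- 2) (bv (0, 0)) = smul (of_int c) (bv (dl 1, c))"
proof -
  have "{nu. is_mono nu \<and> mwt nu = 0} = {0}" using mwt_eq_0_iff by auto
  thus "modeaux k 0 (0, c) (- 1) (bv (0, 0)) = bv (0, c)" by (simp add: eop_vacuum)
  show "modeaux k 0 (0, c) (- 2) (bv (0, 0)) = smul (of_int c) (bv (dl 1, c))"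
    using mwt_one by (simp add: eop_vacuum)
  have "{nu. is_mono nu \<and> int (mwt nu) = - n - 1} = {}" if "n \<ge> 0" using that by auto
  thus "n \<ge> 0 \<Longrightarrow> modeaux k 0 (0, c) n (bv (0, 0)) = 0" by (simp add: eop_vacuum)
qed

lemma mode_vacuum_1:
  assumes "a > 0"
  shows "n \<ge> 0 \<Longrightarrow> modeaux k (Suc 0) (dl a, c) n (bv (0, 0)) = 0"
    and "modeaux k (Suc 0) (dl a, c) (- 1) (bv (0, 0)) = bv (dl a, c)"
    and "modeaux k (Suc 0) (dl a, c) (- 2) (bv (0, 0))
       = smul (of_int c) (bv (dl 1 + dl a, c)) + smul (of_nat a) (bv (dl (a + 1), c))"
  using mode_vacuum_step[of a 0 k 0 c] assms mode_vacuum_0(1)[of _ k c] mode_vacuum_0(2,3)[of k c]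
  by (simp_all add: zero_fun_apply al_smul al_bv heis_create)

lemma mode_vacuum_2:
  assumes "0 < a" "a \<le> b"
  shows "modeaux k (Suc (Suc 0)) (dl b + dl a, c) (- 2) (bv (0, 0))
       = smul (of_int c) (bv (dl 1 + dl b + dl a, c)) + smul (of_nat b) (bv (dl (b + 1) + dl a, c))
         + smul (of_nat a) (bv (dl b + dl (a + 1), c))"
  using mode_vacuum_step(3)[of a "dl b" k "Suc 0" c] assms mode_vacuum_1(1)[of b _ k c] mode_vacuum_1(2,3)[of b k c]
  by (simp add: al_smul al_add al_bv heis_create)

section \<open>Functionals vanishing on the C2 subspace\<close>

lemma vmode_symm:
  assumes "is_mono l"
  shows "vmode k (symm (bv (l, d))) n u = modeB k (l, d) n u + smul ((- 1) ^ mdeg l) (modeB k (l, - d) n u)"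
  using assms by (simp add: vmode_def symm_def theta_bv lin_add lin_smul)

definition eop_coeff :: "nat \<Rightarrow> int \<Rightarrow> mono \<Rightarrow> mono \<Rightarrow> mono \<Rightarrow> complex" where
  "eop_coeff k d l mu nu = (of_int (- 2 * int k * d)) ^ mdeg mu
     * (\<Prod>j\<in>msupp mu. of_nat (l j choose mu j))
     * (\<Prod>j\<in>msupp nu. (of_int d / of_nat j) ^ nu j / fact (nu j))"

lemma eop_eq:
  "eop k d n (l, c) = (\<Sum>mu\<in>{mu. \<forall>j. mu j \<le> l j}.
     \<Sum>nu\<in>{nu. is_mono nu \<and> int (mwt nu) = int (mwt mu) - 2 * int k * d * c - n - 1}.
       smul (eop_coeff k d l mu nu) (bv (\<lambda>j. l j - mu j + nu j, c + d)))"
  by (simp add: eop_def eop_coeff_def Let_def)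

lemma theta_sum: "theta (sum f A) = (\<Sum>i\<in>A. theta (f i))"
proof (induction A rule: infinite_finite_induct)
  case (insert x F)
  thus ?case by (simp add: theta_add)
qed simp_all

text \<open>Each contracted and each created factor carries exactly one factor
  \<open>d\<close>.\<close>

lemma eop_coeff_neg:
  assumes "is_mono nu"
  shows "eop_coeff k (- d) l mu nu = (- 1) ^ (mdeg mu + mdeg nu) * eop_coeff k d l mu nu"
proof -
  have "(\<Prod>j\<in>msupp nu. ((of_int (- d) :: complex) / of_nat j) ^ nu j / fact (nu j))
      = (\<Prod>j\<in>msupp nu. (- 1) ^ nu j * ((of_int d / of_nat j) ^ nu j / fact (nu j)))"
    by (rule prod.cong) (auto simp: power_mult_distrib[symmetric])
  also have "\<dots> = (- 1) ^ mdeg nu * (\<Prod>j\<in>msupp nu. (of_int d / of_nat j) ^ nu j / fact (nu j))"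
    by (simp only: prod.distrib mdeg_def power_sum)
  finally have "(\<Prod>j\<in>msupp nu. ((of_int (- d) :: complex) / of_nat j) ^ nu j / fact (nu j)) = \<dots>" .
  moreover have "(of_int (- 2 * int k * - d) :: complex) ^ mdeg mu
      = (- 1) ^ mdeg mu * of_int (- 2 * int k * d) ^ mdeg mu"
    by (simp add: power_mult_distrib[symmetric])
  ultimately show ?thesis unfolding eop_coeff_def by (simp only: power_add mult_ac)
qed

text \<open>theta exchanges e^(d alpha) and e^(- d alpha). The signs match because the degree
  changes by that of \<open>nu\<close> minus that of \<open>mu\<close>.\<close>

lemma theta_eop:
  assumes "is_mono l"
  shows "theta (eop k d n (l, c)) = smul ((- 1) ^ mdeg l) (eop k (- d) n (l, - c))"
proof -
  have "theta (smul (eop_coeff k d l mu nu) (bv (\<lambda>j. l j - mu j + nu j, c + d)))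
      = smul ((- 1) ^ mdeg l) (smul (eop_coeff k (- d) l mu nu) (bv (\<lambda>j. l j - mu j + nu j, - c + - d)))"
    if "\<forall>j. mu j \<le> l j" "is_mono nu" for mu nu
  proof -
    let ?m = "\<lambda>j. l j - mu j + nu j"
    have h: "(- 1 :: complex) ^ mdeg ?m * (- 1) ^ mdeg mu = (- 1) ^ mdeg l * (- 1) ^ mdeg nu"
      using mono_sub_add(4)[OF assms that] by (simp add: power_add[symmetric])
    have "(- 1 :: complex) ^ mdeg ?m = (- 1) ^ mdeg l * (- 1) ^ (mdeg mu + mdeg nu)"
      using arg_cong[OF h, of "\<lambda>x. x * (- 1) ^ mdeg mu"] by (simp add: power_add mult_ac)
    hence "eop_coeff k d l mu nu * (- 1) ^ mdeg ?m = (- 1) ^ mdeg l * eop_coeff k (- d) l mu nu"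
      by (simp only: eop_coeff_neg[OF that(2)] mult_ac)
    moreover have "- (c + d) = - c + - d" by simp
    ultimately show ?thesis by (simp only: theta_smul theta_bv vec.scale_scale)
  qed
  thus ?thesis
    unfolding eop_eq theta_sum vec.scale_sum_right by (intro sum.cong) auto
qed

text \<open>alpha(-1)^n, the monomials that the degree induction leaves over.\<close>

definition pw :: "nat \<Rightarrow> mono" where "pw n = (\<lambda>j. if j = 1 then n else 0)"

lemma msupp_pw: "msupp (pw n) = (if n = 0 then {} else {1})"
  by (auto simp: pw_def msupp_def)
lemma is_mono_pw [simp]: "is_mono (pw n)" unfolding is_mono_def msupp_pw by (simp add: pw_def)
lemma mwt_pw [simp]: "mwt (pw n) = n" unfolding mwt_def msupp_pw by (simp add: pw_def)
lemma mdeg_pw [simp]: "mdeg (pw n) = n" unfolding mdeg_def msupp_pw by (simp add: pw_def)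

section \<open>Relations for a linear functional that vanishes on C_2\<close>

locale c2_functional =
  fixes k :: nat and phi :: "vec \<Rightarrow> complex"
  assumes k_ge: "k \<ge> 3"
    and phi_add: "phi (f + g) = phi f + phi g"
    and phi_smul: "phi (smul a f) = a * phi f"
    and phi_C2: "u \<in> VLplus \<Longrightarrow> v \<in> VLplus \<Longrightarrow> phi (vmode k v (- 2) u) = 0"
begin

text \<open>The unknowns of the argument: elements of C_2 give linear relations among these
  numbers.\<close>

definition t :: "int \<Rightarrow> mono \<Rightarrow> complex" where
  "t c l = phi (symm (bv (l, c)))"

lemma phi_0: "phi 0 = 0" using phi_smul[of 0 0] by simp

lemma phi_sum: "phi (sum f A) = (\<Sum>i\<in>A. phi (f i))"
proof (induction A rule: infinite_finite_induct)
  case (insert x F)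
  thus ?case by (simp add: phi_add)
qed (simp_all add: phi_0)

lemma t_neg: "t (- c) l = (- 1) ^ mdeg l * t c l"
  by (simp add: t_def symm_bv_neg phi_smul)

lemma t_0_odd: "odd (mdeg l) \<Longrightarrow> t 0 l = 0"
  using t_neg[of 0 l] by simp

lemma t_heis:
  "j > 0 \<Longrightarrow> phi (symm (al k (- int j) (bv (l, c)))) = t c (l + dl j)"
  "j > 0 \<Longrightarrow> j' > 0 \<Longrightarrow> is_mono l \<Longrightarrow>
     phi (symm (al k (- int j) (al k (- int j') (bv (l, c))))) = t c (l + dl j' + dl j)"
  "j > 0 \<Longrightarrow> is_mono l \<Longrightarrow>
     phi (symm (al k (- int j) (al k 0 (bv (l, c))))) = of_nat (2 * k) * of_int c * t c (l + dl j)"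
  "i > 0 \<Longrightarrow> j > 0 \<Longrightarrow> is_mono l \<Longrightarrow> phi (symm (al k (- int j) (al k (int i) (bv (l, c)))))
     = of_nat (2 * k * i * l i) * t c (l(i := l i - 1) + dl j)"
  using is_mono_dec[of l i]
  by (simp_all add: t_def al_bv heis_create heis_zero heis_annihilate al_smul symm_smul phi_smul)

text \<open>The functional is applied to (alpha(-a) alpha(-b) 1)_{-2} of a symmetrised basis vector.
  The first two terms have top degree; alpha(0) gives the charge term and alpha(i) with i > 0
  contracts a part of \<open>l\<close>, both of lower degree.\<close>

lemma rel_quadratic_le:
  assumes l: "is_mono l" and a: "0 < a" and ab: "a \<le> b"
  shows "of_nat a * t c (l + dl b + dl (a + 1)) + of_nat b * t c (l + dl (b + 1) + dl a)
    + quad_coeff a b 0 * (of_nat (2 * k) * of_int c) * t c (l + dl (a + b + 1))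
    + (\<Sum>i\<in>msupp l. quad_coeff a b i * of_nat (2 * k * i * l i) * t c (l(i := l i - 1) + dl (a + b + 1 + i))) = 0"
proof -
  have b: "b > 0" using a ab by simp
  define U where "U = symm (bv (l, c))"
  have U: "U \<in> VLplus" "U \<in> VL" unfolding U_def using l by (simp_all add: symm_VLplus symm_VL)
  \<comment> \<open>Large enough for the mode formula and to reach every part of
    \<open>l\<close>.\<close>
  define K where "K = max (vwt k U) (mwt l)"
  let ?X = "modeaux k (Suc (Suc 0)) (dl b + dl a, 0) (- 2) U"
  have "phi (vmode k (symm (bv (dl b + dl a, 0))) (- 2) U) = 0"
    by (rule phi_C2[OF U(1)]) (simp add: symm_VLplus a b)
  \<comment> \<open>alpha(-a) alpha(-b) 1 is already theta-fixed, so symmetrising doubles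
    it.\<close>
  also have "vmode k (symm (bv (dl b + dl a, 0))) (- 2) U = smul 2 ?X"
    using a b vec.scale_left_distrib[of 1 1 ?X] by (simp add: vmode_symm modeB_def numeral_2_eq_2)
  finally have "phi ?X = 0" by (simp add: phi_smul)
  moreover have X: "?X = smul (of_nat a) (al k (- int (a + 1)) (al k (- int b) U))
    + smul (of_nat b) (al k (- int a) (al k (- int (b + 1)) U))
    + (\<Sum>i\<le>K. smul (quad_coeff a b i) (al k (- int (a + b + 1 + i)) (al k (int i) U)))"
    by (rule mode_quadratic) (simp_all add: a ab U K_def)
  moreover have alal: "phi (al k m (al k n U)) = phi (symm (al k m (al k n (bv (l, c)))))" for m n
    unfolding U_def using l by (simp add: al_al_symm)
  let ?f = "\<lambda>i. quad_coeff a b i * phi (symm (al k (- int (a + b + 1 + i)) (al k (int i) (bv (l, c)))))"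
  have "phi ?X = of_nat a * t c (l + dl b + dl (a + 1)) + of_nat b * t c (l + dl (b + 1) + dl a) + (\<Sum>i\<le>K. ?f i)"
    unfolding X phi_add phi_smul phi_sum alal using a b l by (simp only: t_heis(2) add_gr_0 simp_thms)
  moreover have "(\<Sum>i\<le>K. ?f i) = ?f 0 + (\<Sum>i\<in>{1..K}. ?f i)"
    by (simp add: atMost_atLeast0 sum.atLeast_Suc_atMost[of 0 K])
  moreover have "?f 0 = quad_coeff a b 0 * (of_nat (2 * k) * of_int c) * t c (l + dl (a + b + 1))"
    using t_heis(3)[of "a + b + 1" l c] l by (simp only: of_nat_0 add_0_right mult.assoc)
  moreover have "(\<Sum>i\<in>{1..K}. ?f i) =
      (\<Sum>i\<in>msupp l. quad_coeff a b i * of_nat (2 * k * i * l i) * t c (l(i := l i - 1) + dl (a + b + 1 + i)))"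
  proof (rule sum.mono_neutral_cong_right)
    have "i \<in> {1..K}" if "l i \<noteq> 0" for i
      using that mono_bounded(2)[OF l, of "mwt l" i] l
      by (cases "i = 0") (auto simp: is_mono_def K_def not_less le_max_iff_disj)
    thus "msupp l \<subseteq> {1..K}" by (auto simp: msupp_def)
    show "\<forall>i\<in>{1..K} - msupp l. ?f i = 0"
      using t_heis(4)[OF _ _ l, of _ "a + b + 1 + _" c] by (auto simp: msupp_def)
    show "?f i = quad_coeff a b i * of_nat (2 * k * i * l i) * t c (l(i := l i - 1) + dl (a + b + 1 + i))"
      if "i \<in> msupp l" for i
      using t_heis(4)[OF _ _ l, of i "a + b + 1 + i" c] that l
      by (cases "i = 0") (simp_all add: msupp_def is_mono_def mult.assoc)
  qed simp
  ultimately show ?thesis by (simp only: add.assoc)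
qed

lemma quad_coeff_commute: "quad_coeff a b i = quad_coeff b a i"
  by (simp add: quad_coeff_def add_ac)

lemma rel_quadratic:
  assumes l: "is_mono l" and a: "0 < a" and b: "0 < b"
  shows "of_nat a * t c (l + dl b + dl (a + 1)) + of_nat b * t c (l + dl (b + 1) + dl a)
    + quad_coeff a b 0 * (of_nat (2 * k) * of_int c) * t c (l + dl (a + b + 1))
    + (\<Sum>i\<in>msupp l. quad_coeff a b i * of_nat (2 * k * i * l i) * t c (l(i := l i - 1) + dl (a + b + 1 + i))) = 0"
proof (cases "a \<le> b")
  case False
  thus ?thesis using rel_quadratic_le[OF l b, of a c]
    by (simp add: quad_coeff_commute[of b a] add_ac)
qed (use rel_quadratic_le[OF l a] in blast)

text \<open>E_{-2} with E = e^(d alpha) + e^(- d alpha) acts on a symmetrised vector. As theta swaps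
  the two exponentials, the four terms regroup into two symmetrisations.\<close>

lemma rel_exp:
  assumes l: "is_mono l"
  shows "phi (symm (eop k d (- 2) (l, c))) + phi (symm (eop k (- d) (- 2) (l, c))) = 0"
proof -
  have eq: "lin (eop k d (- 2)) (symm (bv (l, c))) = eop k d (- 2) (l, c) + theta (eop k (- d) (- 2) (l, c))" for d
    using l by (simp add: symm_def theta_bv lin_add lin_smul theta_eop)
  have "phi (vmode k (symm (bv (0, d))) (- 2) (symm (bv (l, c)))) = 0"
    by (rule phi_C2) (simp_all add: symm_VLplus l)
  thus ?thesis
    by (simp add: vmode_symm modeB_def eq) (simp add: symm_def phi_add add_ac)
qed

lemma phi_eop:
  "phi (symm (eop k d n (l, c))) = (\<Sum>mu\<in>{mu. \<forall>j. mu j \<le> l j}.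
     \<Sum>nu\<in>{nu. is_mono nu \<and> int (mwt nu) = int (mwt mu) - 2 * int k * d * c - n - 1}.
       eop_coeff k d l mu nu * t (c + d) (\<lambda>j. l j - mu j + nu j))"
  by (simp only: eop_eq symm_sum phi_sum symm_smul phi_smul t_def)

text \<open>All terms lie in the single charge c + d and in one monomial weight, fixed by the mode
  index.\<close>

lemma phi_eop_eq_0:
  assumes l: "is_mono l"
    and van: "\<And>m. is_mono m \<Longrightarrow> int (mwt m) = int (mwt l) - 2 * int k * d * c - n - 1 \<Longrightarrow> t (c + d) m = 0"
  shows "phi (symm (eop k d n (l, c))) = 0"
  unfolding phi_eop
proof (intro sum.neutral ballI)
  fix mu nu assume "mu \<in> {mu. \<forall>j. mu j \<le> l j}"
    "nu \<in> {nu. is_mono nu \<and> int (mwt nu) = int (mwt mu) - 2 * int k * d * c - n - 1}"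
  hence mu: "\<forall>j. mu j \<le> l j" and nu: "is_mono nu" "int (mwt nu) = int (mwt mu) - 2 * int k * d * c - n - 1"
    by auto
  have "t (c + d) (\<lambda>j. l j - mu j + nu j) = 0"
    by (rule van[OF mono_sub_add(2)[OF l mu nu(1)]]) (use mono_sub_add(3)[OF l mu nu(1)] nu(2) in linarith)
  thus "eop_coeff k d l mu nu * t (c + d) (\<lambda>j. l j - mu j + nu j) = 0" by simp
qed

text \<open>As \<open>l\<close> has no part 1, alpha(-1)^N can only arise by contracting all of
  \<open>l\<close> and creating every factor alpha(-1). This one term survives, with a coefficient
  that is nonzero when k and d are.\<close>

lemma phi_eop_leading:
  assumes l: "is_mono l" "l 1 = 0"
    and N: "int N = int (mwt l) - 2 * int k * d * c - n - 1"
    and van: "\<And>m. is_mono m \<Longrightarrow> mwt m = N \<Longrightarrow> m \<noteq> pw N \<Longrightarrow> t (c + d) m = 0"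
  shows "phi (symm (eop k d n (l, c))) =
    of_int (- 2 * int k * d) ^ mdeg l * (of_int d ^ N / fact N) * t (c + d) (pw N)"
proof -
  let ?N = "\<lambda>mu. {nu. is_mono nu \<and> int (mwt nu) = int (mwt mu) - 2 * int k * d * c - n - 1}"
  have fN: "finite (?N mu)" for mu
    by (rule finite_subset[OF _ finite_mono_mwt_le[of "nat (int (mwt mu) - 2 * int k * d * c - n - 1)"]]) auto
  have summand: "eop_coeff k d l mu nu * t (c + d) (\<lambda>j. l j - mu j + nu j)
     = (if nu = pw N then if mu = l then eop_coeff k d l l (pw N) * t (c + d) (pw N) else 0 else 0)"
    if mu: "\<forall>j. mu j \<le> l j" and nu: "nu \<in> ?N mu" for mu nu
  proof -
    let ?m = "\<lambda>j. l j - mu j + nu j"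
    have m: "is_mono ?m" "mwt ?m = N"
      using mono_sub_add(2,3)[OF l(1) mu, of nu] nu N by auto
    have iff: "?m = pw N \<longleftrightarrow> mu = l \<and> nu = pw N"
    proof
      assume *: "?m = pw N"
      have "mu j = l j" for j
      proof (cases "j = 1")
        case True thus ?thesis using l(2) mu by (metis le_zero_eq)
      next
        case False
        hence "l j - mu j + nu j = 0" using fun_cong[OF *, of j] by (simp add: pw_def)
        thus ?thesis using mu by (metis add_is_0 diff_is_0_eq le_antisym)
      qed
      hence "mu = l" by auto
      thus "mu = l \<and> nu = pw N" using * by (auto simp: fun_eq_iff)
    qed auto
    show ?thesis
    proof (cases "?m = pw N")
      case True thus ?thesis using iff by simp
    next
      case False
      hence "t (c + d) ?m = 0" using van[OF m] by simp
      thus ?thesis using False iff by auto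
    qed
  qed
  have "phi (symm (eop k d n (l, c))) = (\<Sum>mu\<in>{mu. \<forall>j. mu j \<le> l j}. \<Sum>nu\<in>?N mu.
      if nu = pw N then if mu = l then eop_coeff k d l l (pw N) * t (c + d) (pw N) else 0 else 0)"
    unfolding phi_eop by (intro sum.cong refl summand) auto
  also have "\<dots> = (\<Sum>mu\<in>{mu. \<forall>j. mu j \<le> l j}. if mu = l then eop_coeff k d l l (pw N) * t (c + d) (pw N) else 0)"
    by (rule sum.cong) (use N in \<open>auto simp: fN\<close>)
  also have "\<dots> = eop_coeff k d l l (pw N) * t (c + d) (pw N)"
    using finite_mono_le[OF l(1)] by simp
  also have "eop_coeff k d l l (pw N) = of_int (- 2 * int k * d) ^ mdeg l * (of_int d ^ N / fact N)"
    by (simp add: eop_coeff_def msupp_pw) (simp add: pw_def)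
  finally show ?thesis .
qed

text \<open>L(-1) v = v_{-2} 1 lies in C_2; here v is the symmetrised alpha(-a) e^(c alpha).\<close>

lemma rel_translation_1:
  assumes "a > 0"
  shows "of_int c * t c (dl 1 + dl a) + of_nat a * t c (dl (a + 1)) = 0"
proof -
  have eq: "vmode k (symm (bv (dl a, c))) (- 2) (bv (0, 0))
      = symm (smul (of_int c) (bv (dl 1 + dl a, c)) + smul (of_nat a) (bv (dl (a + 1), c)))"
    using assms vmode_symm[of "dl a" k c "- 2" "bv (0, 0)"]
    by (simp add: modeB_def mode_vacuum_1) (simp add: symm_def theta_add theta_smul theta_bv
        vec.scale_right_distrib)
  have "phi (vmode k (symm (bv (dl a, c))) (- 2) (bv (0, 0))) = 0"
    by (rule phi_C2) (simp_all add: symm_VLplus assms bv_vacuum)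
  thus ?thesis using assms
    by (simp only: eq symm_add symm_smul phi_add phi_smul t_def)
qed

lemma rel_translation_2:
  assumes "a > 0" "b > 0"
  shows "of_int c * t c (dl 1 + dl b + dl a) + of_nat b * t c (dl (b + 1) + dl a)
    + of_nat a * t c (dl b + dl (a + 1)) = 0"
proof -
  have le: "of_int c * t c (dl 1 + dl b + dl a) + of_nat b * t c (dl (b + 1) + dl a)
    + of_nat a * t c (dl b + dl (a + 1)) = 0" if a: "a > 0" "a \<le> b" for a b :: nat
  proof -
    have b: "b > 0" using a by simp
    have eq: "vmode k (symm (bv (dl b + dl a, c))) (- 2) (bv (0, 0))
      = symm (smul (of_int c) (bv (dl 1 + dl b + dl a, c)) + smul (of_nat b) (bv (dl (b + 1) + dl a, c))
         + smul (of_nat a) (bv (dl b + dl (a + 1), c)))"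
      using a b vmode_symm[of "dl b + dl a" k c "- 2" "bv (0, 0)"]
      by (simp add: modeB_def mode_vacuum_2[simplified]) (simp add: symm_def theta_add theta_smul theta_bv
          vec.scale_right_distrib)
    have "phi (vmode k (symm (bv (dl b + dl a, c))) (- 2) (bv (0, 0))) = 0"
      by (rule phi_C2) (simp_all add: symm_VLplus a b bv_vacuum)
    thus ?thesis using a b
      by (simp only: eq symm_add symm_smul phi_add phi_smul t_def)
  qed
  show ?thesis
  proof (cases "a \<le> b")
    case False
    thus ?thesis using le[of b a] assms by (simp add: add_ac)
  qed (use le assms in blast)
qed

end

section \<open>Vanishing in a fixed sector\<close>

text \<open>Moving one unit between two slots changes the sign, so every value is
  \<open>f S 0 0\<close> up to sign. The relation between f(1,0,S-1) and f(0,1,S-1) joins values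
  that are equal by symmetry, so these vanish.\<close>

lemma symmetric_antiderivation_zero:
  fixes f :: "nat \<Rightarrow> nat \<Rightarrow> nat \<Rightarrow> complex"
  assumes s1: "\<And>i j l. f i j l = f j i l" and s2: "\<And>i j l. f i j l = f i l j"
    and rel: "\<And>i j l. i + j + l + 1 = S \<Longrightarrow> f (i + 1) j l + f i (j + 1) l = 0"
    and S: "S \<ge> 1" and ijl: "i + j + l = S"
  shows "f i j l = 0"
proof -
  have a: "f i j l = (- 1) ^ j * f (i + j) 0 l" if "i + j + l = S" for i j l
    using that
  proof (induction j arbitrary: i)
    case (Suc j)
    have "f (i + 1) j l + f i (j + 1) l = 0" by (rule rel) (use Suc.prems in simp)
    thus ?case using Suc.IH[of "i + 1"] Suc.prems by (simp add: add_eq_0_iff)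
  qed simp
  have "f i j l = (- 1) ^ j * f (i + j) l 0" using a[OF ijl] s2 by metis
  also have "\<dots> = (- 1) ^ j * ((- 1) ^ l * f S 0 0)" using a[of "i + j" l 0] ijl by simp
  also have "f S 0 0 = - f (S - 1) 1 0"
    using rel[of "S - 1" 0 0] S by (simp add: add_eq_0_iff2)
  also have "f (S - 1) 1 0 = 0"
  proof -
    have "f 1 0 (S - 1) + f 0 1 (S - 1) = 0" using rel[of 0 0 "S - 1"] S by simp
    moreover have "f 0 1 (S - 1) = f 1 0 (S - 1)" by (rule s1)
    moreover have "f 0 1 (S - 1) = f (S - 1) 1 0" using s1 s2 by metis
    ultimately show ?thesis by simp
  qed
  finally show ?thesis by simp
qed

section \<open>Reduction to degree at most two\<close>

context c2_functional
begin

text \<open>Three factors of \<open>l\<close> are singled out and the rest is frozen. With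
  factorials, \<open>rel_quadratic\<close> becomes the sign rule of
  \<open>symmetric_antiderivation_zero\<close>, since its charge and contraction terms have the same
  weight but smaller degree.\<close>

lemma degree_step:
  assumes D: "D \<ge> 3" and l: "is_mono l" "mwt l = N" "mdeg l = D" "l \<noteq> pw N"
    and low: "\<And>m. is_mono m \<Longrightarrow> mwt m = N \<Longrightarrow> mdeg m < D \<Longrightarrow> t c m = 0"
  shows "t c l = 0"
proof -
  \<comment> \<open>One of the three chosen parts must exceed 1, so that the index sum is at least
    1.\<close>
  have "\<exists>j. j \<noteq> 1 \<and> l j \<noteq> 0"
  proof (rule ccontr)
    assume "\<not> ?thesis"
    hence e: "l = pw (l 1)" by (auto simp: pw_def fun_eq_iff)
    hence "mwt l = l 1" by (metis mwt_pw)
    thus False using e l by simp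
  qed
  then obtain j where j: "j \<noteq> 1" "l j \<noteq> 0" by blast
  from mono_split[OF l(1) j(2)] obtain r where r: "is_mono r" "l = r + dl j" "j > 0" by blast
  define i where "i = j - 1"
  have i: "i \<ge> 1" "j = i + 1" using j r by (auto simp: i_def)
  have "mdeg r \<noteq> 0" using l r D by auto
  from mono_obtain_part[OF r(1) this] obtain r1 p where r1: "is_mono r1" "r = r1 + dl (Suc p)" by blast
  have "mdeg r1 \<noteq> 0" using l r r1 D by auto
  from mono_obtain_part[OF r1(1) this] obtain r2 q where r2: "is_mono r2" "r1 = r2 + dl (Suc q)" by blast
  have l_eq: "l = r2 + dl (q + 1) + dl (p + 1) + dl (i + 1)" using r r1 r2 i by simp
  have deg: "mdeg r2 + 3 = D" and wt: "mwt r2 + q + p + i + 3 = N"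
    using l r2(1) unfolding l_eq by simp_all
  define f where "f = (\<lambda>i j h. fact i * fact j * fact h * t c (r2 + dl (i + 1) + dl (j + 1) + dl (h + 1)))"
  have "f i p q = 0"
  proof (rule symmetric_antiderivation_zero)
    show "f i j h = f j i h" "f i j h = f i h j" for i j h by (simp_all add: f_def add_ac mult_ac)
    show "1 \<le> i + p + q" using i by simp
    fix i' j' h assume s: "i' + j' + h + 1 = i + p + q"
    let ?L = "r2 + dl (h + 1)"
    have L: "is_mono ?L" "mdeg ?L + 2 = D" "mwt ?L + i' + j' + 3 = N" using r2(1) deg wt s by auto
    have "t c (?L + dl (i' + 1 + (j' + 1) + 1)) = 0"
      by (rule low) (use L r2(1) in auto)
    moreover have "t c (?L(x := ?L x - 1) + dl (i' + 1 + (j' + 1) + 1 + x)) = 0" if "x \<in> msupp ?L" for x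
    proof -
      have "?L x \<noteq> 0" using that unfolding msupp_def by simp
      from mono_split[OF L(1) this] obtain R where R: "is_mono R" "?L = R + dl x" "x > 0" by blast
      have e: "?L(x := ?L x - 1) = R" unfolding R(2) by (rule mono_upd_dec)
      have "mdeg ?L = mdeg R + 1" "mwt ?L = mwt R + x" unfolding R(2) using R(1,3) by simp_all
      thus ?thesis unfolding e by (intro low) (use R(1) L(2,3) in auto)
    qed
    ultimately have "of_nat (i' + 1) * t c (?L + dl (j' + 1) + dl (i' + 1 + 1))
        + of_nat (j' + 1) * t c (?L + dl (j' + 1 + 1) + dl (i' + 1)) = 0"
      using rel_quadratic[OF L(1), of "i' + 1" "j' + 1" c] by simp
    hence "fact i' * fact j' * fact h * (of_nat (i' + 1) * t c (?L + dl (j' + 1) + dl (i' + 1 + 1))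
        + of_nat (j' + 1) * t c (?L + dl (j' + 1 + 1) + dl (i' + 1))) = 0" by simp
    thus "f (i' + 1) j' h + f i' (j' + 1) h = 0"
      by (simp add: f_def algebra_simps)
  qed simp
  thus ?thesis by (simp add: f_def l_eq add_ac)
qed

lemma vanish_of_low_degree:
  assumes low: "\<And>m. is_mono m \<Longrightarrow> mwt m = N \<Longrightarrow> mdeg m \<le> 2 \<Longrightarrow> t c m = 0"
    and "is_mono l" "mwt l = N" "l \<noteq> pw N"
  shows "t c l = 0"
  using assms(2-)
proof (induction "mdeg l" arbitrary: l rule: less_induct)
  case less
  show ?case
  proof (cases "mdeg l \<le> 2")
    case False
    show ?thesis
    proof (rule degree_step[OF _ less.prems(1,2) refl less.prems(3)])
      fix m assume m: "is_mono m" "mwt m = N" "mdeg m < mdeg l"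
      \<comment> \<open>alpha(-1)^N has the largest degree possible in weight N, so it is not among
        the monomials of smaller degree.\<close>
      have "m \<noteq> pw N" using m mdeg_le_mwt[OF less.prems(1)] less.prems(2) by (metis mdeg_pw not_le)
      thus "t c m = 0" using less.hyps m by blast
    qed (use False in simp)
  qed (use low less.prems in blast)
qed

\<comment> \<open>The factorials turn alpha(-n-1) into the n-th derivative of alpha(-1), so that the
  translation operator acts by shifting an index.\<close>
definition x1 :: "int \<Rightarrow> nat \<Rightarrow> complex" where
  "x1 c n = fact n * t c (dl (n + 1))"
definition x2 :: "int \<Rightarrow> nat \<Rightarrow> nat \<Rightarrow> complex" where
  "x2 c i j = fact i * fact j * t c (dl (i + 1) + dl (j + 1))"
definition x3 :: "int \<Rightarrow> nat \<Rightarrow> nat \<Rightarrow> nat \<Rightarrow> complex" where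
  "x3 c i j l = fact i * fact j * fact l * t c (dl (i + 1) + dl (j + 1) + dl (l + 1))"

text \<open>\<open>delta\<close> gives the normalised alpha(0) coefficient of the quadratic
  relation; \<open>eps\<close> solves \<open>eps i + eps (Suc i) = delta i\<close>, which lets this
  inhomogeneous term be absorbed.\<close>

definition delta :: "nat \<Rightarrow> complex" where "delta i = (- 1) ^ i / ((of_nat i + 1) * (of_nat i + 2))"
definition eps :: "nat \<Rightarrow> complex" where "eps i = (- 1) ^ i / (of_nat i + 1)"

lemma of_nat_plus_nonzero: "(of_nat n + 1 :: complex) \<noteq> 0" "(of_nat n + 2 :: complex) \<noteq> 0"
  using of_nat_eq_0_iff[where 'a = complex, of "n + 1"] of_nat_eq_0_iff[where 'a = complex, of "n + 2"]
  by (simp_all del: of_nat_eq_0_iff) (metis add.commute)+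

lemma eps_add: "eps i + eps (Suc i) = delta i"
  using of_nat_plus_nonzero[of i] by (simp add: eps_def delta_def field_simps)

section \<open>Monomials of degree one and two\<close>

lemma x2_commute: "x2 c i j = x2 c j i"
  by (simp add: x2_def add_ac mult_ac)

lemma quad_coeff_0: "fact i * fact j * quad_coeff (i + 1) (j + 1) 0 = (delta i + delta j) * fact (i + j + 2)"
proof -
  have *: "fact i * fact j * of_nat ((i + j + 2) choose (j + 2)) = (fact (i + j + 2) / ((of_nat j + 1) * (of_nat j + 2)) :: complex)" for i j
  proof -
    have "(of_nat ((i + j + 2) choose (j + 2)) :: complex) = fact (i + j + 2) / (fact (j + 2) * fact i)"
      by (subst binomial_fact) simp_all
    also have "(fact (j + 2) :: complex) = (of_nat j + 1) * (of_nat j + 2) * fact j"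
      by (simp add: algebra_simps)
    finally show ?thesis using of_nat_plus_nonzero[of j] by simp
  qed
  have "fact i * fact j * quad_coeff (i + 1) (j + 1) 0 =
      (- 1) ^ j * (fact i * fact j * of_nat ((i + j + 2) choose (j + 2)))
    + (- 1) ^ i * (fact j * fact i * of_nat ((j + i + 2) choose (i + 2)))"
    by (simp add: quad_coeff_def algebra_simps)
  also have "\<dots> = (delta i + delta j) * fact (i + j + 2)"
    unfolding * by (simp only: delta_def add.commute[of j i] distrib_right times_divide_eq_left
        times_divide_eq_right add.commute[of "(- 1) ^ j * fact (i + j + 2) / _"])
  finally show ?thesis .
qed

lemma x2_rel: "x2 c (Suc i) j + x2 c i (Suc j) + of_nat (2 * k) * of_int c * (delta i + delta j) * x1 c (i + j + 2) = 0"
proof -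
  have "of_nat (i + 1) * t c (dl (j + 1) + dl (i + 2)) + of_nat (j + 1) * t c (dl (j + 2) + dl (i + 1))
    + quad_coeff (i + 1) (j + 1) 0 * (of_nat (2 * k) * of_int c) * t c (dl (i + j + 3)) = 0"
    using rel_quadratic[of 0 "i + 1" "j + 1" c] by (simp add: add_ac numeral_eq_Suc)
  hence "fact i * fact j * (of_nat (i + 1) * t c (dl (j + 1) + dl (i + 2)) + of_nat (j + 1) * t c (dl (j + 2) + dl (i + 1)))
    + (fact i * fact j * quad_coeff (i + 1) (j + 1) 0) * (of_nat (2 * k) * of_int c) * t c (dl (i + j + 3)) = 0"
    by (metis (no_types, lifting) distrib_left mult.assoc mult_zero_right)
  thus ?thesis unfolding quad_coeff_0 by (simp add: x1_def x2_def algebra_simps numeral_eq_Suc)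
qed

text \<open>By \<open>x2_rel\<close>, the \<open>eps\<close>-corrected value changes sign when a
  unit moves from one index to the other. Hence all degree two values of a given weight are fixed by
  one of them together with \<open>x1\<close>.\<close>

lemma x2_form:
  assumes "i + j = M"
  shows "x2 c i j + of_nat (2 * k) * of_int c * (eps i + eps j) * x1 c (M + 1)
     = (- 1) ^ i * (x2 c 0 M + of_nat (2 * k) * of_int c * (eps 0 + eps M) * x1 c (M + 1))"
  (is "_ = _ * ?q")
  using assms
proof (induction i arbitrary: j)
  case (Suc i)
  have IH: "x2 c i (Suc j) + of_nat (2 * k) * of_int c * (eps i + eps (Suc j)) * x1 c (M + 1)
     = (- 1) ^ i * ?q"
    using Suc by simp
  have "i + j + 2 = M + 1" using Suc.prems by simp
  hence "x2 c (Suc i) j + x2 c i (Suc j)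
     + of_nat (2 * k) * of_int c * (eps i + eps (Suc i) + (eps j + eps (Suc j))) * x1 c (M + 1) = 0"
    using x2_rel[of c i j] unfolding eps_add by metis
  hence "x2 c (Suc i) j + of_nat (2 * k) * of_int c * (eps (Suc i) + eps j) * x1 c (M + 1)
     + (x2 c i (Suc j) + of_nat (2 * k) * of_int c * (eps i + eps (Suc j)) * x1 c (M + 1)) = 0"
    by (simp add: algebra_simps)
  thus ?case unfolding IH power_Suc by (simp add: eq_neg_iff_add_eq_0)
qed simp

lemma x1_x2: "x1 c (M + 1) + of_int c * x2 c 0 M = 0"
proof -
  have "fact M * (of_int c * t c (dl 1 + dl (M + 1)) + of_nat (M + 1) * t c (dl (M + 1 + 1))) = 0"
    using rel_translation_1[of "M + 1" c] by simp
  thus ?thesis by (simp add: x1_def x2_def algebra_simps)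
qed

text \<open>Swapping the indices 0 and M is a symmetry, but moving M units produces the sign
  (-1)^M.\<close>

lemma x2_odd:
  assumes "odd M"
  shows "x2 c 0 M + of_nat (2 * k) * of_int c * (eps 0 + eps M) * x1 c (M + 1) = 0"
    (is "?A = 0")
proof -
  have "?A = - ?A"
    using x2_form[of M 0 M c] assms by (simp only: x2_commute[of c M 0] add.commute[of "eps M"]) simp
  hence "2 * ?A = 0" by (simp only: mult_2 eq_neg_iff_add_eq_0)
  thus ?thesis by (metis mult_eq_0_iff zero_neq_numeral)
qed

text \<open>Eliminating \<open>x2 c 0 M\<close> between translation and the parity argument leaves X
  (M + 1 - 2 k c^2 M) = 0, and the integer is negative since 2 k c^2 is at least 6.\<close>

lemma x1_odd:
  assumes "c \<noteq> 0" "odd M"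
  shows "x1 c (M + 1) = 0"
proof -
  let ?X = "x1 c (M + 1)"
  have M: "M \<ge> 1" using assms(2) by (cases M) auto
  have "x2 c 0 M = - (of_nat (2 * k) * of_int c * (eps 0 + eps M) * ?X)"
    using x2_odd[OF assms(2), of c] by (simp add: eq_neg_iff_add_eq_0)
  hence "?X - of_int c * (of_nat (2 * k) * of_int c * (eps 0 + eps M) * ?X) = 0"
    using x1_x2[of c M] by simp
  hence "?X * (1 - of_nat (2 * k) * of_int c * of_int c * (eps 0 + eps M)) = 0"
    by (simp add: algebra_simps)
  also have "eps 0 + eps M = of_nat M / (of_nat M + 1)"
    using assms(2) of_nat_plus_nonzero[of M] by (simp add: eps_def field_simps)
  finally have "?X * ((of_nat M + 1) - of_nat (2 * k) * of_int c * of_int c * of_nat M) = 0"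
    using of_nat_plus_nonzero[of M] by (simp add: field_simps)
  moreover have "(of_nat M + 1) - of_nat (2 * k) * of_int c * of_int c * of_nat M
      = (of_int (int M + 1 - 2 * int k * (c * c) * int M) :: complex)" by simp
  moreover have "int M + 1 - 2 * int k * (c * c) * int M \<noteq> 0"
  proof -
    have "c * c \<ge> 1" using assms(1) by (metis int_one_le_iff_zero_less not_square_less_zero linorder_neqE_linordered_idom mult_eq_0_iff)
    hence "2 * int k * (c * c) \<ge> 6 * 1" using k_ge by (intro mult_mono) auto
    hence "2 * int k * (c * c) * int M \<ge> 6 * int M" by (intro mult_right_mono) auto
    thus ?thesis using M by linarith
  qed
  ultimately show ?thesis by (metis mult_eq_0_iff of_int_eq_0_iff)
qed

lemma x3_rel_translation: "of_int c * x3 c 0 i j + x2 c (Suc i) j + x2 c i (Suc j) = 0"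
proof -
  have "fact i * fact j * (of_int c * t c (dl 1 + dl (j + 1) + dl (i + 1)) + of_nat (j + 1) * t c (dl (j + 1 + 1) + dl (i + 1))
    + of_nat (i + 1) * t c (dl (j + 1) + dl (i + 1 + 1))) = 0"
    using rel_translation_2[of "i + 1" "j + 1" c] by simp
  thus ?thesis by (simp add: x3_def x2_def algebra_simps)
qed

lemma quad_coeff_11: "quad_coeff 1 1 i = 2"
  by (simp add: quad_coeff_def)

lemma quad_coeff_22: "quad_coeff 2 2 i = - 2 * (of_nat i + 4) * (of_nat i + 1)"
proof -
  have "(i + 4) choose (i + 3) = i + 4" using binomial_symmetric[of "i + 3" "i + 4"] by simp
  moreover have "Suc i choose i = Suc i" by simp
  ultimately show ?thesis by (simp add: quad_coeff_def add_ac numeral_eq_Suc algebra_simps)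
qed

lemma x3_rel_quadratic:
  "2 * x3 c 0 1 l + of_nat (2 * k) * of_int c * x2 c 2 l
     + 2 * of_nat (2 * k) / ((of_nat l + 2) * (of_nat l + 3)) * x1 c (l + 3) = 0"
proof -
  have e: "(dl (l + 1))(l + 1 := dl (l + 1) (l + 1) - 1) = 0"
    by (simp add: fun_eq_iff zero_fun_apply)
  have "2 * t c (dl (l + 1) + dl 1 + dl 2) + 2 * (of_nat (2 * k) * of_int c) * t c (dl (l + 1) + dl 3)
    + 2 * of_nat (2 * k * (l + 1)) * t c (dl (l + 4)) = 0"
    using rel_quadratic[of "dl (l + 1)" 1 1 c] unfolding quad_coeff_11 msupp_dl
    by (simp add: e[simplified] add_ac numeral_eq_Suc)
  hence H: "fact l * (2 * t c (dl (l + 1) + dl 1 + dl 2) + 2 * (of_nat (2 * k) * of_int c) * t c (dl (l + 1) + dl 3)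
    + 2 * of_nat (2 * k * (l + 1)) * t c (dl (l + 4))) = 0" by simp
  have x1: "2 * of_nat (2 * k) / ((of_nat l + 2) * (of_nat l + 3)) * x1 c (l + 3)
      = fact l * (2 * of_nat (2 * k * (l + 1)) * t c (dl (l + 4)))"
  proof -
    have "(fact (l + 3) :: complex) = (of_nat l + 3) * (of_nat l + 2) * of_nat (l + 1) * fact l"
      by (simp add: numeral_eq_Suc algebra_simps)
    moreover have "(of_nat l + 3 :: complex) \<noteq> 0" "(of_nat l + 2 :: complex) \<noteq> 0"
      using of_nat_plus_nonzero[of "l + 2"] of_nat_plus_nonzero[of l] by (simp_all add: add_ac)
    ultimately show ?thesis by (simp add: x1_def add.commute[of l 4]) (simp add: algebra_simps)
  qed
  have x2: "x2 c 2 l = fact l * (2 * t c (dl (l + 1) + dl 3))"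
    by (simp add: x2_def add.commute[of "dl 3"])
  have x3: "x3 c 0 1 l = fact l * t c (dl (l + 1) + dl 1 + dl 2)"
    by (simp add: x3_def add_ac numeral_eq_Suc)
  show ?thesis using H unfolding x1 x2 x3 by (simp only: distrib_left mult_ac)
qed

text \<open>Here the index sum is even and the parity argument does not apply. Instead
  \<open>x3 c 0 1 l\<close> is computed twice, by translation and by (alpha(-1)^2)_{-2} on
  alpha(-l-1) e^(c alpha). Expressing everything through X gives 2 k r X = 0 with r > 0.\<close>

lemma x1_even:
  assumes "c \<noteq> 0" "even l" "l \<ge> 2"
  shows "x1 c (l + 3) = 0"
proof -
  let ?X = "x1 c (l + 3)" and ?K = "of_nat (2 * k) :: complex" and ?c = "of_int c :: complex"
  have c: "?c \<noteq> 0" and K: "?K \<noteq> 0" using assms(1) k_ge by auto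
  have x3: "x3 c 0 1 l = ?K * (delta 1 + delta l) * ?X"
  proof -
    have "x2 c (Suc 1) l + x2 c 1 (Suc l) = - (?K * ?c * (delta 1 + delta l) * ?X)"
      using x2_rel[of c 1 l] by (simp add: eq_neg_iff_add_eq_0 numeral_eq_Suc)
    hence "?c * x3 c 0 1 l - ?K * ?c * (delta 1 + delta l) * ?X = 0"
      using x3_rel_translation[of c 1 l] by (simp add: add.assoc)
    hence "?c * (x3 c 0 1 l - ?K * (delta 1 + delta l) * ?X) = 0" by (simp add: algebra_simps)
    thus ?thesis using c by simp
  qed
  have x20: "x2 c 0 (l + 2) = - ?X / ?c"
    using x1_x2[of c "l + 2"] c by (simp add: field_simps eq_neg_iff_add_eq_0 numeral_eq_Suc)
  have x22: "x2 c 2 l = - ?X / ?c + ?K * ?c * (eps 0 + eps (l + 2)) * ?X - ?K * ?c * (eps 2 + eps l) * ?X"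
    using x2_form[of 2 l "l + 2" c] x20 by (simp add: algebra_simps numeral_eq_Suc)
  have "?K * (?X * (2 * (delta 1 + delta l) - 1 + ?K * ?c * ?c * (eps 0 + eps (l + 2) - eps 2 - eps l)
      + 2 / ((of_nat l + 2) * (of_nat l + 3)))) = 0"
    using x3_rel_quadratic[of c l] c unfolding x3 x22 by (simp add: algebra_simps)
  moreover define r :: real where "r = 2 * (- 1 / 6 + 1 / ((real l + 1) * (real l + 2))) - 1
      + 2 * real k * (real_of_int c)\<^sup>2 * (1 + 1 / (real l + 3) - 1 / 3 - 1 / (real l + 1)) + 2 / ((real l + 2) * (real l + 3))"
  have "2 * (delta 1 + delta l) - 1 + ?K * ?c * ?c * (eps 0 + eps (l + 2) - eps 2 - eps l)
      + 2 / ((of_nat l + 2) * (of_nat l + 3)) = of_real r"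
    using assms(2) by (simp add: r_def delta_def eps_def power2_eq_square algebra_simps)
  moreover have "r > 0"
  proof -
    have "c * c \<ge> 1" using assms(1) by (metis int_one_le_iff_zero_less not_square_less_zero linorder_neqE_linordered_idom mult_eq_0_iff)
    hence "real_of_int (c * c) \<ge> 1" by linarith
    hence c2: "(real_of_int c)\<^sup>2 \<ge> 1" by (simp add: power2_eq_square)
    have l: "real l \<ge> 2" using assms(3) by simp
    have "(real l + 1) * (real l + 3) \<ge> 3 * 5" using l by (intro mult_mono) auto
    hence "2 / ((real l + 1) * (real l + 3)) \<le> 2 / 15" by (simp add: field_simps)
    moreover have "1 / (real l + 1) - 1 / (real l + 3) = 2 / ((real l + 1) * (real l + 3))"
      using l by (simp add: field_simps)
    \<comment> \<open>1 - 1/3 - 2/15 = 8/15, so the charge term is at least 6 times 8/15, that is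
      16/5, and outweighs the negative constants, which sum to -4/3.\<close>
    ultimately have b: "1 + 1 / (real l + 3) - 1 / 3 - 1 / (real l + 1) \<ge> 8 / 15" by linarith
    define P where "P = 2 * real k * (real_of_int c)\<^sup>2 * (1 + 1 / (real l + 3) - 1 / 3 - 1 / (real l + 1))"
    define A where "A = 1 / ((real l + 1) * (real l + 2))"
    define B where "B = 2 / ((real l + 2) * (real l + 3))"
    have "6 * 1 * (8 / 15) \<le> P"
      unfolding P_def using b c2 k_ge by (intro mult_mono) auto
    hence "P \<ge> 16 / 5" by simp
    moreover have "A \<ge> 0" "B \<ge> 0" by (simp_all add: A_def B_def)
    moreover have "r = 2 * A + P + B - 4 / 3" by (simp add: r_def P_def A_def B_def)
    ultimately show ?thesis by linarith
  qed
  ultimately show ?thesis using K by (metis less_irrefl mult_eq_0_iff of_real_eq_0_iff)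
qed

lemma x1_zero:
  assumes "c \<noteq> 0" "M \<ge> 3"
  shows "x1 c (M + 1) = 0"
proof (cases "odd M")
  case True thus ?thesis by (rule x1_odd[OF assms(1)])
next
  case False
  hence "even (M - 2)" "M - 2 \<ge> 2" "M + 1 = (M - 2) + 3" using assms(2) by presburger+
  thus ?thesis using x1_even[OF assms(1)] by metis
qed

lemma x2_zero:
  assumes "c \<noteq> 0" "i + j = M" "M \<ge> 3"
  shows "x2 c i j = 0"
  using x2_form[OF assms(2), of c] x1_zero[OF assms(1,3)] x1_x2[of c M] assms(1) by simp

text \<open>With c = 0 the corrections drop out and \<open>x2 0 i j\<close> is (-1)^i q. For odd M
  symmetry gives q = 0; for even M two degree four relations share a leading monomial, and their
  combination leaves q times a nonzero number.\<close>

lemma x2_zero_sector_0: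
  assumes "i + j = M" "M \<ge> 8"
  shows "x2 0 i j = 0"
proof (cases "odd M")
  case True
  thus ?thesis using x2_form[OF assms(1), of 0] x2_odd[of M 0] by simp
next
  case False
  \<comment> \<open>The weight M + 2 is that of alpha(-1) alpha(-2) alpha(-3) alpha(-d), and
    \<open>d \<ge> 4\<close> keeps alpha(-d) distinct from the other factors.\<close>
  define d where "d = M - 4"
  have d: "d \<ge> 4" "even d" "M = d + 4" using assms False by (auto simp: d_def)
  define q where "q = x2 0 0 M"
  have x2: "x2 0 i j = (- 1) ^ i * q" if "i + j = M" for i j
    using x2_form[OF that, of 0] by (simp add: q_def)
  have upd: "(dl p + dl d)(p := (dl p + dl d) p - 1) = dl d" "(dl p + dl d)(d := (dl p + dl d) d - 1) = dl p"
    if "p \<noteq> d" for p using that by (auto simp: fun_eq_iff plus_fun_apply)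
  have r22: "2 * t 0 (dl 1 + dl d + dl 2 + dl 3) + 2 * t 0 (dl 1 + dl d + dl 3 + dl 2)
      + quad_coeff 2 2 1 * of_nat (2 * k) * t 0 (dl d + dl 6)
      + quad_coeff 2 2 d * of_nat (2 * k * d) * t 0 (dl 1 + dl (5 + d)) = 0"
    using rel_quadratic[of "dl 1 + dl d" 2 2 0] d upd[of 1] by (simp add: plus_fun_apply add.assoc) (simp only: add_ac)
  have r11: "t 0 (dl 3 + dl d + dl 1 + dl 2) + t 0 (dl 3 + dl d + dl 2 + dl 1)
      + quad_coeff 1 1 3 * of_nat (2 * k * 3) * t 0 (dl d + dl 6)
      + quad_coeff 1 1 d * of_nat (2 * k * d) * t 0 (dl 3 + dl (3 + d)) = 0"
    using rel_quadratic[of "dl 3 + dl d" 1 1 0] d upd[of 3] by (simp add: plus_fun_apply add.assoc) (simp add: add_ac numeral_2_eq_2 numeral_3_eq_3)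
  have "dl 3 + dl d + dl 1 + dl 2 = dl 1 + dl d + dl 2 + dl 3" "dl 3 + dl d + dl 2 + dl 1 = dl 1 + dl d + dl 2 + dl 3"
    "dl 1 + dl d + dl 3 + dl 2 = dl 1 + dl d + dl 2 + dl 3" by (simp_all add: add_ac)
  \<comment> \<open>Twice \<open>r11\<close> minus \<open>r22\<close>: the quartic terms
    cancel.\<close>
  hence "of_nat (2 * k) * (32 * t 0 (dl d + dl 6) + 2 * (of_nat d + 4) * (of_nat d + 1) * of_nat d * t 0 (dl 1 + dl (5 + d))
      + 4 * of_nat d * t 0 (dl 3 + dl (3 + d))) = 0"
    using r22 r11 unfolding quad_coeff_11 quad_coeff_22 by (simp add: algebra_simps) algebra
  moreover have "(of_nat (2 * k) :: complex) \<noteq> 0" using k_ge by simp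
  ultimately have rel: "32 * t 0 (dl d + dl 6) + 2 * (of_nat d + 4) * (of_nat d + 1) * of_nat d * t 0 (dl 1 + dl (5 + d))
      + 4 * of_nat d * t 0 (dl 3 + dl (3 + d)) = 0"
    by (metis mult_eq_0_iff)
  define e where "e = d - 1"
  have e: "d = e + 1" using d by (simp add: e_def)
  have f: "(fact (e + 5) :: complex) = (of_nat d + 4) * (of_nat d + 3) * (of_nat d + 2) * (of_nat d + 1) * of_nat d * fact e"
    "(fact (e + 3) :: complex) = (of_nat d + 2) * (of_nat d + 1) * of_nat d * fact e"
    by (simp_all add: e numeral_eq_Suc algebra_simps)
  have "x2 0 5 e = - q" "x2 0 0 (e + 5) = q" "x2 0 2 (e + 3) = q"
    using x2[of 5 e] x2[of 0 "e + 5"] x2[of 2 "e + 3"] d e by simp_all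
  hence T: "120 * fact e * t 0 (dl d + dl 6) = - q" "fact (e + 5) * t 0 (dl 1 + dl (5 + d)) = q"
      "2 * fact (e + 3) * t 0 (dl 3 + dl (3 + d)) = q"
    unfolding x2_def by (simp_all add: e add_ac fact_numeral numeral_3_eq_3)
  have n: "(of_nat d :: complex) \<noteq> 0" "(of_nat d + 1 :: complex) \<noteq> 0" "(of_nat d + 2 :: complex) \<noteq> 0"
      "(of_nat d + 3 :: complex) \<noteq> 0" "(of_nat d + 4 :: complex) \<noteq> 0"
    using of_nat_plus_nonzero[of d] of_nat_plus_nonzero[of "d + 2"] of_nat_plus_nonzero[of "d + 3"] d(1) by (simp_all add: add_ac)
  have T': "t 0 (dl d + dl 6) = - q / (120 * fact e)" "t 0 (dl 1 + dl (5 + d)) = q / fact (e + 5)"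
     "t 0 (dl 3 + dl (3 + d)) = q / (2 * fact (e + 3))"
    using T by (simp_all add: field_simps)
  have cancel: "32 * (- q / (120 * F)) + 2 * d4 * d1 * d0 * (q / (d4 * d3 * d2 * d1 * d0 * F)) + 4 * d0 * (q / (2 * (d2 * d1 * d0 * F)))
      = q * (- 32 / 120 + 2 / (d2 * d3) + 2 / (d1 * d2)) / F"
    if "d0 \<noteq> 0" "d1 \<noteq> 0" "d2 \<noteq> 0" "d3 \<noteq> 0" "d4 \<noteq> 0" "F \<noteq> 0" for d0 d1 d2 d3 d4 F :: complex
    using that by (simp add: field_simps)
  have "q * (- 32 / 120 + 2 / ((of_nat d + 2) * (of_nat d + 3)) + 2 / ((of_nat d + 1) * (of_nat d + 2))) = 0"
    using rel unfolding T' f cancel[OF n fact_nonzero] by simp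
  moreover define r :: real where "r = - 32 / 120 + 2 / ((real d + 2) * (real d + 3)) + 2 / ((real d + 1) * (real d + 2))"
  have "(- 32 / 120 + 2 / ((of_nat d + 2) * (of_nat d + 3)) + 2 / ((of_nat d + 1) * (of_nat d + 2)) :: complex) = of_real r"
    by (simp add: r_def)
  \<comment> \<open>For d >= 4 the positive fractions are at most 1/21 + 1/15, less than
    32/120.\<close>
  moreover have "r < 0"
  proof -
    have "(real d + 2) * (real d + 3) \<ge> 6 * 7" "(real d + 1) * (real d + 2) \<ge> 5 * 6"
      using d(1) by (intro mult_mono; simp)+
    hence "2 / ((real d + 2) * (real d + 3)) \<le> 2 / 42" "2 / ((real d + 1) * (real d + 2)) \<le> 2 / 30"
      by (simp_all add: field_simps)
    thus ?thesis unfolding r_def by linarith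
  qed
  ultimately have "q = 0" by (metis less_irrefl mult_eq_0_iff of_real_eq_0_iff)
  thus ?thesis using x2[OF assms(1)] by simp
qed

section \<open>Vanishing of whole sectors in large weight\<close>

lemma low_degree_forms:
  assumes "is_mono m" "mwt m = N" "mdeg m \<le> 2" "N > 0"
  shows "(\<exists>n. N = n + 1 \<and> m = dl (n + 1)) \<or> (\<exists>i j. N = i + j + 2 \<and> m = dl (i + 1) + dl (j + 1))"
proof -
  have "m \<noteq> 0" using assms by auto
  have ne: "mdeg m \<noteq> 0"
  proof
    assume "mdeg m = 0"
    hence "m = 0" using assms(1) finite_msupp[of m] by (auto simp: mdeg_def msupp_def fun_eq_iff zero_fun_apply)
    thus False using \<open>m \<noteq> 0\<close> by simp
  qed
  from mono_obtain_part[OF assms(1) ne] obtain r i where r: "is_mono r" "m = r + dl (Suc i)" by blast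
  show ?thesis
  proof (cases "mdeg r = 0")
    case True
    hence "r = 0" using r(1) finite_msupp[of r] by (auto simp: mdeg_def msupp_def fun_eq_iff zero_fun_apply)
    thus ?thesis using r assms(2) by auto
  next
    case False
    from mono_obtain_part[OF r(1) this] obtain s j where s: "is_mono s" "r = s + dl (Suc j)" by blast
    have "mdeg s = 0" using s r assms(3) by simp
    hence "s = 0" using s(1) finite_msupp[of s] by (auto simp: mdeg_def msupp_def fun_eq_iff zero_fun_apply)
    thus ?thesis using r s assms(2) by (intro disjI2 exI[of _ j] exI[of _ i]) auto
  qed
qed

lemma sector_vanish_non_power:
  assumes "c \<noteq> 0" "N \<ge> 5" "is_mono m" "mwt m = N" "m \<noteq> pw N"
  shows "t c m = 0"
proof (rule vanish_of_low_degree[OF _ assms(3-5)])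
  fix m assume m: "is_mono m" "mwt m = N" "mdeg m \<le> 2"
  have "N > 0" using assms(2) by simp
  from low_degree_forms[OF m this] show "t c m = 0"
  proof (elim disjE exE conjE)
    fix n assume "N = n + 1" "m = dl (n + 1)"
    thus ?thesis using x1_zero[OF assms(1), of "n - 1"] assms(2) by (simp add: x1_def)
  next
    fix i j assume "N = i + j + 2" "m = dl (i + 1) + dl (j + 1)"
    thus ?thesis using x2_zero[OF assms(1), of i j "i + j"] assms(2) by (simp add: x2_def)
  qed
qed

text \<open>Only alpha(-1)^N is left. E_{-2} with E = e^(c alpha) + e^(- c alpha) sends the charge 0
  vector alpha(-2) alpha(-(N-3)) to monomial weight N in charges c and - c. As its degree is even,
  the two contributions agree and add up instead of cancelling.\<close>

lemma sector_vanish: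
  assumes "c \<noteq> 0" "N \<ge> 5" "is_mono m" "mwt m = N"
  shows "t c m = 0"
proof -
  let ?l = "dl 2 + dl (N - 3)"
  have l: "is_mono ?l" "?l 1 = 0" "mwt ?l = N - 1" "mdeg ?l = 2"
    using assms(2) by (auto simp: plus_fun_apply)
  have "phi (symm (eop k d (- 2) (?l, 0))) =
      of_int (- 2 * int k * d) ^ 2 * (of_int d ^ N / fact N) * t d (pw N)" if "d \<noteq> 0" for d
  proof -
    have "int N = int (mwt ?l) - 2 * int k * d * 0 - - 2 - 1" using l(3) assms(2) by simp
    moreover have "t (0 + d) m = 0" if "is_mono m" "mwt m = N" "m \<noteq> pw N" for m
      using sector_vanish_non_power[OF \<open>d \<noteq> 0\<close> assms(2) that] by simp
    ultimately show ?thesis using phi_eop_leading[OF l(1,2)] l(4) by fastforce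
  qed
  from this[of c] this[of "- c"] rel_exp[OF l(1), of c 0] assms(1)
  have "of_int (- 2 * int k * c) ^ 2 * (of_int c ^ N / fact N) * t c (pw N)
     + of_int (- 2 * int k * - c) ^ 2 * (of_int (- c) ^ N / fact N) * t (- c) (pw N) = 0"
    by simp
  also have "t (- c) (pw N) = (- 1) ^ N * t c (pw N)" by (simp add: t_neg)
  also have "(of_int (- c) :: complex) ^ N = (- 1) ^ N * of_int c ^ N"
    by (simp add: power_mult_distrib[symmetric])
  finally have "2 * (of_int (2 * int k * c) ^ 2 * (of_int c ^ N / fact N) * t c (pw N)) = 0"
    by (simp add: power2_eq_square mult_ac)
  hence "t c (pw N) = 0" using assms(1) k_ge by simp
  thus ?thesis using sector_vanish_non_power[OF assms] by blast
qed

lemma sector_0_vanish_non_power: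
  assumes "N \<ge> 10" "is_mono m" "mwt m = N" "m \<noteq> pw N"
  shows "t 0 m = 0"
proof (rule vanish_of_low_degree[OF _ assms(2-4)])
  fix m assume m: "is_mono m" "mwt m = N" "mdeg m \<le> 2"
  have "N > 0" using assms(1) by simp
  from low_degree_forms[OF m this] show "t 0 m = 0"
  proof (elim disjE exE conjE)
    fix n assume "m = dl (n + 1)"
    thus ?thesis by (simp add: t_0_odd)
  next
    fix i j assume "N = i + j + 2" "m = dl (i + 1) + dl (j + 1)"
    thus ?thesis using x2_zero_sector_0[of i j "i + j"] assms(1) by (simp add: x2_def)
  qed
qed

text \<open>alpha(-1)^N in charge 0 is reached from alpha(-r) e^(- alpha) by the e^alpha part of E.
  The other part lands in charge -2 with monomial weight N - 4k, which \<open>sector_vanish\<close>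
  covers.\<close>

lemma sector_0_vanish:
  assumes "N \<ge> 4 * k + 10" "is_mono m" "mwt m = N"
  shows "t 0 m = 0"
proof -
  \<comment> \<open>e^alpha raises the monomial weight by 2k + 1 here: 2k from the pairing of the
    charges and 1 from the mode -2.\<close>
  define r where "r = N - 2 * k - 1"
  have r: "r \<ge> 2" "N = r + 2 * k + 1" using assms(1) by (auto simp: r_def)
  have l: "is_mono (dl r)" "dl r 1 = 0" using r by auto
  have "phi (symm (eop k 1 (- 2) (dl r, - 1))) =
      of_int (- 2 * int k) * (1 / fact N) * t 0 (pw N)"
  proof -
    have "int N = int (mwt (dl r)) - 2 * int k * 1 * - 1 - - 2 - 1" using r(2) by simp
    moreover have "t (- 1 + 1) m = 0" if "is_mono m" "mwt m = N" "m \<noteq> pw N" for m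
      using sector_0_vanish_non_power[OF _ that] assms(1) by simp
    ultimately show ?thesis using phi_eop_leading[OF l] by fastforce
  qed
  moreover have "phi (symm (eop k (- 1) (- 2) (dl r, - 1))) = 0"
  proof (rule phi_eop_eq_0[OF l(1)])
    fix m assume "is_mono m" "int (mwt m) = int (mwt (dl r)) - 2 * int k * - 1 * - 1 - - 2 - 1"
    thus "t (- 1 + - 1) m = 0"
      using assms(1) r by (intro sector_vanish[of _ "mwt m"]) auto
  qed
  ultimately have "t 0 (pw N) = 0" using rel_exp[OF l(1), of 1 "- 1"] k_ge by simp
  thus ?thesis using sector_0_vanish_non_power[of N m] assms by (cases "m = pw N") auto
qed

end

section \<open>Sectors of large charge and conclusion\<close>

context c2_functional
begin

\<comment> \<open>The left-hand side is the functional on x^l S_s e^(c alpha), with S_s the Schur polynomial; for s = 0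
  this is x^l e^(c alpha). In E_{-2} applied to x^l alpha(-h-s) e^((c-1) alpha), any part of l that is
  contracted leaves a term with smaller l.\<close>
lemma large_sector_convolution:
  assumes c: "c \<ge> 3" and h: "int h = 2 * int k * (c - 1) - 1"
    and l: "is_mono l" "mwt l < h"
  shows "(\<Sum>nu\<in>{nu. is_mono nu \<and> mwt nu = s}. eop_coeff k 1 0 0 nu * t c (l + nu)) = 0"
  using l
proof (induction "mwt l" arbitrary: l s rule: less_induct)
  case less
  let ?P = "\<lambda>l s. \<Sum>nu\<in>{nu. is_mono nu \<and> mwt nu = s}. eop_coeff k 1 0 0 nu * t c (l + nu)"
  \<comment> \<open>The e^alpha part of E_{-2} forces \<open>nu\<close> to have the weight of
    \<open>mu\<close> minus \<open>h\<close>, so contracting only alpha(-r) creates monomials of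
    weight \<open>s\<close>.\<close>
  define r where "r = h + s"
  have h11: "h \<ge> 11"
  proof -
    have "2 * int k * (c - 1) \<ge> 6 * 2" using c k_ge by (intro mult_mono) auto
    thus ?thesis using h by linarith
  qed
  have r: "r > 0" "mwt l < r" using less.prems h11 by (auto simp: r_def)
  have lr: "l r = 0" using mono_bounded(2)[OF less.prems(1) order_refl r(2)] .
  let ?l = "l + dl r"
  have L: "is_mono ?l" "mwt ?l = mwt l + r" using less.prems r by auto
  let ?N = "\<lambda>mu. {nu. is_mono nu \<and> int (mwt nu) = int (mwt mu) - 2 * int k * 1 * (c - 1) - - 2 - 1}"
  have inner: "(\<Sum>nu\<in>?N mu. eop_coeff k 1 ?l mu nu * t (c - 1 + 1) (\<lambda>j. ?l j - mu j + nu j))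
      = (if mu = dl r then - of_nat (2 * k) * ?P l s else 0)" (is "?I = _")
    if mu: "\<forall>j. mu j \<le> ?l j" for mu
  proof (cases "mu r = 0")
    \<comment> \<open>Without contracting alpha(-r) the weight of \<open>mu\<close> is below
      \<open>h\<close>, and no \<open>nu\<close> fits.\<close>
    case True
    have "mu j \<le> l j" for j using mu[rule_format, of j] True by (cases "j = r") (auto simp: plus_fun_apply)
    hence "mwt mu \<le> mwt l" using mono_sub_add(3)[OF less.prems(1) _ is_mono_0, of mu] by auto
    hence "?N mu = {}" using less.prems h by auto
    hence "?I = 0" by (simp only: sum.empty)
    thus ?thesis using True by auto
  next
    case False
    have mur: "mu r = 1" using mu[rule_format, of r] lr False by (simp add: plus_fun_apply)
    define mu' where "mu' = mu(r := 0)"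
    have mu'_le: "\<forall>j. mu' j \<le> l j"
    proof
      fix j show "mu' j \<le> l j"
        using mu[rule_format, of j] by (cases "j = r") (auto simp: plus_fun_apply mu'_def)
    qed
    have mu_eq: "mu = mu' + dl r" using mur by (auto simp: mu'_def fun_eq_iff plus_fun_apply)
    define ka where "ka = (\<lambda>j. l j - mu' j)"
    have ka0: "(\<lambda>j. l j - mu' j + (0 :: mono) j) = ka" by (simp add: ka_def zero_fun_apply)
    have mono: "is_mono mu'" "is_mono ka" "mwt ka + mwt mu' = mwt l"
      using mono_sub_add(1-3)[OF less.prems(1) mu'_le is_mono_0] unfolding ka0 by simp_all
    have N: "?N mu = {nu. is_mono nu \<and> mwt nu = mwt mu' + s}"
    proof -
      have "mwt mu = mwt mu' + (h + s)" unfolding mu_eq using mono(1) r by (simp add: r_def)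
      thus ?thesis using h by auto
    qed
    have arg: "(\<lambda>j. ?l j - mu j + nu j) = ka + nu" for nu
      by (auto simp: mu_eq ka_def fun_eq_iff plus_fun_apply)
    define A where "A = (of_int (- 2 * int k * 1) :: complex) ^ mdeg mu * (\<Prod>j\<in>msupp mu. of_nat (?l j choose mu j))"
    have co: "eop_coeff k 1 ?l mu nu = A * eop_coeff k 1 0 0 nu" for nu
      by (simp add: eop_coeff_def A_def)
    have I: "?I = A * ?P ka (mwt mu' + s)"
      unfolding N co arg by (simp add: sum_distrib_left mult.assoc)
    show ?thesis
    proof (cases "mu' = 0")
      case True
      hence "mu = dl r" "ka = l" using mu_eq by (simp_all add: ka_def zero_fun_apply)
      moreover from this have "A = - of_nat (2 * k)" by (simp add: A_def plus_fun_apply lr)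
      ultimately show ?thesis using I True by simp
    next
      \<comment> \<open>Contracting a part of \<open>l\<close> leaves \<open>ka\<close> of smaller
        weight, to which the induction applies with \<open>s\<close> enlarged by the weight of
        \<open>mu'\<close>.\<close>
      case False
      hence "mwt ka < mwt l" using mono mwt_eq_0_iff[OF mono(1)] by linarith
      hence "?P ka (mwt mu' + s) = 0" using less.hyps mono(2) less.prems(2) by simp
      moreover have "mu \<noteq> dl r" using False mu_eq by simp
      ultimately show ?thesis using I by simp
    qed
  qed
  have "phi (symm (eop k 1 (- 2) (?l, c - 1))) = (\<Sum>mu\<in>{mu. \<forall>j. mu j \<le> ?l j}. if mu = dl r then - of_nat (2 * k) * ?P l s else 0)"
    unfolding phi_eop by (intro sum.cong refl inner) simp
  also have "\<dots> = - of_nat (2 * k) * ?P l s"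
    using finite_mono_le[OF L(1)] by (auto simp: plus_fun_apply)
  finally have e1: "phi (symm (eop k 1 (- 2) (?l, c - 1))) = - of_nat (2 * k) * ?P l s" .
  \<comment> \<open>The other exponential lands in charge c - 2 >= 1 with monomial weight above 2k(c
    - 1), where \<open>sector_vanish\<close> applies.\<close>
  have "phi (symm (eop k (- 1) (- 2) (?l, c - 1))) = 0"
  proof (rule phi_eop_eq_0[OF L(1)])
    fix m assume m: "is_mono m" "int (mwt m) = int (mwt ?l) - 2 * int k * - 1 * (c - 1) - - 2 - 1"
    have "int (mwt m) = int (mwt l + r) + 2 * int k * (c - 1) + 1" using m(2) L(2) by simp
    hence "mwt m \<ge> 5" using h h11 by linarith
    thus "t (c - 1 + - 1) m = 0" using c m(1) by (intro sector_vanish[of _ "mwt m"]) auto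
  qed
  hence *: "- of_nat (2 * k) * ?P l s = 0" using e1 rel_exp[OF L(1), of 1 "c - 1"] by (simp only: add_0_right)
  have "(- of_nat (2 * k) :: complex) \<noteq> 0" using k_ge by simp
  thus ?case using iffD1[OF mult_eq_0_iff *] by blast
qed

text \<open>After \<open>sector_vanish\<close> the weights below 5 are left. They are below
  \<open>h\<close>, so the convolution identity applies, and for s = 0 it reduces to the single
  value wanted.\<close>

lemma large_sector_vanish:
  assumes c: "c \<ge> 3" and m: "is_mono m"
  shows "t c m = 0"
proof (cases "mwt m \<ge> 5")
  case True
  thus ?thesis using sector_vanish[of c "mwt m" m] assms by simp
next
  case False
  have ge: "2 * int k * (c - 1) \<ge> 6 * 2" using c k_ge by (intro mult_mono) auto
  define h where "h = nat (2 * int k * (c - 1) - 1)"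
  have h: "int h = 2 * int k * (c - 1) - 1" "mwt m < h" using ge False by (auto simp: h_def)
  have "{nu. is_mono nu \<and> mwt nu = 0} = {0}" using mwt_eq_0_iff by auto
  hence "eop_coeff k 1 0 0 0 * t c (m + 0) = 0"
    using large_sector_convolution[OF c h(1) m h(2), of 0] by simp
  thus ?thesis by (simp add: eop_coeff_def)
qed

lemma t_eq_0:
  assumes "is_mono l" "\<bar>c\<bar> > 2 \<or> mwt l > 4 * k + 10"
  shows "t c l = 0"
proof (cases "\<bar>c\<bar> > 2")
  case True
  show ?thesis
  proof (cases "c \<ge> 3")
    case False
    hence "t (- c) l = 0" using True assms(1) by (intro large_sector_vanish) auto
    thus ?thesis using t_neg[of c l] by simp
  qed (use large_sector_vanish assms(1) in blast)
next
  case False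
  hence wt: "mwt l > 4 * k + 10" using assms(2) by simp
  show ?thesis
    using assms(1) sector_vanish[of c "mwt l" l] sector_0_vanish[of "mwt l" l] wt by (cases "c = 0") simp_all
qed

end

section \<open>Finite codimension of C_2\<close>

lemma C2plus_eq_span: "C2plus k = vec.span {vmode k v (- 2) u | u v. u \<in> VLplus \<and> v \<in> VLplus}"
  by (simp add: C2plus_def cspan_eq_span)

text \<open>Otherwise a separating functional would be an instance of the locale with a nonzero
  value of \<open>t\<close>.\<close>

lemma symm_bv_in_C2plus:
  assumes "k \<ge> 3" "is_mono l" "\<bar>c\<bar> > 2 \<or> mwt l > 4 * k + 10"
  shows "symm (bv (l, c)) \<in> C2plus k"
proof (rule ccontr)
  assume "\<not> ?thesis"
  then obtain f :: "vec \<Rightarrow> complex" where f: "\<forall>y z. f (y + z) = f y + f z" "\<forall>a y. f (smul a y) = a * f y"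
    "\<forall>s\<in>{vmode k v (- 2) u | u v. u \<in> VLplus \<and> v \<in> VLplus}. f s = 0" "f (symm (bv (l, c))) = 1"
    using separating_functional[of "symm (bv (l, c))"] unfolding C2plus_eq_span by blast
  interpret c2_functional k f
    by unfold_locales (rule assms(1), use f(1) in simp, use f(2) in simp, use f(3) in blast)
  show False using t_eq_0[OF assms(2,3)] f(4) by (simp add: t_def)
qed

theorem mainTheorem1:
  fixes k :: nat
  assumes "k \<ge> 3"
  shows "C2_cofinite k"
proof -
  \<comment> \<open>The finitely many basis vectors not covered by
    \<open>symm_bv_in_C2plus\<close>.\<close>
  let ?B = "{l. is_mono l \<and> mwt l \<le> 4 * k + 10} \<times> {- 2..2 :: int}"
  let ?F = "(\<lambda>b. symm (bv b)) ` ?B"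
  have "\<exists>c\<in>C2plus k. v - c \<in> cspan ?F" if v: "v \<in> VLplus" for v
  proof -
    let ?g = "\<lambda>b. smul (v b / 2) (symm (bv b))"
    have fin: "finite (vsupp v)" and sub: "vsupp v \<subseteq> basis_set" and th: "theta v = v"
      using v by (auto simp: VLplus_def VL_def)
    \<comment> \<open>A fixed vector is half its symmetrisation, hence a combination of symmetrised
      basis vectors; those outside \<open>?B\<close> lie in C_2.\<close>
    have "v = smul (1 / 2) (symm v)"
      by (simp only: symm_def th vec.scale_right_distrib vec.scale_left_distrib[symmetric]) simp
    also have "symm v = (\<Sum>b\<in>vsupp v. smul (v b) (symm (bv b)))"
      using arg_cong[OF vec_expand[OF fin], of symm] by (simp only: symm_sum symm_smul)
    also have "smul (1 / 2) \<dots> = sum ?g (vsupp v)"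
      by (simp add: vec.scale_sum_right)
    also have "\<dots> = sum ?g (vsupp v \<inter> ?B) + sum ?g (vsupp v - ?B)"
      using fin by (rule sum.Int_Diff)
    finally have e: "v - sum ?g (vsupp v - ?B) = sum ?g (vsupp v \<inter> ?B)"
      by (rule iffD2[OF diff_eq_eq])
    have "sum ?g (vsupp v \<inter> ?B) \<in> cspan ?F"
      unfolding cspan_eq_span by (intro vec.span_sum vec.span_scale vec.span_base) blast
    moreover have "sum ?g (vsupp v - ?B) \<in> C2plus k"
    proof -
      have "symm (bv b) \<in> C2plus k" if "b \<in> vsupp v - ?B" for b
        using symm_bv_in_C2plus[OF assms, of "fst b" "snd b"] that sub
        by (cases b) (auto simp: subset_iff)
      thus ?thesis
        unfolding C2plus_eq_span by (intro vec.span_sum vec.span_scale) blast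
    qed
    ultimately show ?thesis unfolding e[symmetric] by blast
  qed
  moreover have "finite ?F" using finite_mono_mwt_le by simp
  moreover have "?F \<subseteq> VLplus" by (auto intro!: symm_VLplus)
  ultimately show ?thesis unfolding C2_cofinite_def by blast
qed

end
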